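(* Let $F$ be a fixed finite set of denial constraints. Consider the following nondeterministic algorithm, called GlobalRepair, taking as input an instance $I$ and a priority $\succ$ of $I$ w.r.t. $F$: (1) construct a repair $I'$ of $I$ w.r.t. $F$ with the basic repairing algorithm; (2) while there exist a nonempty $X\subseteq I'$ and $Y\subseteq I\setminus I'$ such that $\forall x\in X.\ \exists y\in Y.\ y\succ x$ and $(I'\setminus X)\cup Y$ is consistent with $F$: choose such $X,Y$, set $J:=(I'\setminus X)\cup Y$, extend $J$ to a repair $I''$ of $I$ w.r.t. $F$ by considering the facts of $I\setminus J$ one by one in any order and adding each one that does not create an inconsistency, and set $I':=I''$; (3) return $I'$. This algorithm is a sound and complete algorithm constructing globally-optimal repairs: every run terminates and returns a repair of $I$ w.r.t. $F$ that is globally optimal w.r.t. $\succ$ and $F$, and every such globally-optimal repair is returned by some run. Moreover it works in time exponential in the size of $I$ and $\succ$.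
   Context: A database schema is a set of relation names of fixed positive arity; each attribute ranges over one of two disjoint infinite domains: the rationals $\mathbb{Q}$ (with built-in predicates $=,\neq,<,\le,>,\ge$) or a set $D$ of uninterpreted constants (with built-in predicates $=,\neq$). A fact is an expression $R(t)$ with $R$ a relation name and $t$ a tuple of constants of the right arity and types. A database instance is a finite set of facts. A denial constraint is a sentence $\forall\bar x.\ \neg[R_1(\bar x_1)\wedge\dots\wedge R_n(\bar x_n)\wedge\varphi(\bar x)]$ with $n>0$, $\bar x_1\cup\dots\cup\bar x_n=\bar x$, and $\varphi$ a quantifier-free formula using only built-in predicates. A set of facts $\{R_1(t_1),\dots,R_n(t_n)\}\subseteq I$ is a conflict in $I$ w.r.t. $F$ if for some denial constraint $\forall\bar x.\ \neg[R_1(\bar x_1)\wedge\dots\wedge R_n(\bar x_n)\wedge\varphi(\bar x)]$ in $F$ there is a substitution $\rho$ of constants for $\bar x$ such that $\varphi(\rho(\bar x))$ is true and $\rho(\bar x_i)=t_i$ for all $i$; an instance is consistent with $F$ iff it satisfies $F$, i.e. iff it contains no conflict. A repair of $I$ w.r.t. $F$ is a maximal (under inclusion) subset of $I$ consistent with $F$. Two facts of $I$ are neighbors if some conflict contains both. A priority of $I$ w.r.t. $F$ is an acyclic binary relation $\succ$ on $I$ such that $x\succ y$ implies that $x$ and $y$ are neighbors. A set $I'\subseteq I$ is globally optimal w.r.t. $\succ$ and $F$ if there are no nonempty $X\subseteq I'$ and $Y\subseteq I\setminus I'$ such that $\forall x\in X.\ \exists y\in Y.\ y\succ x$ and $(I'\setminus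 X)\cup Y$ is consistent with $F$. Basic repairing algorithm: start with $J=\varnothing$, go through the facts of $I$ in an arbitrary (nondeterministically chosen) order, adding the current fact to $J$ if the result is consistent with $F$ and discarding it otherwise; return $J$. Complexity is data complexity: $F$ is fixed. *)

theory Defs
  imports Complex_Main "HOL-Library.Log_Nat"
begin

section \<open>Schemas, instances and denial constraints\<close>

datatype 'd const = Q rat | D 'd

datatype sort = Rational | Uninterpreted

primrec sort_of :: "'d const \<Rightarrow> sort" where
  "sort_of (Q q) = Rational"
| "sort_of (D d) = Uninterpreted"

type_synonym 'r schema = "'r \<Rightarrow> sort list option"

definition db_schema :: "'r schema \<Rightarrow> bool" where
  "db_schema S \<longleftrightarrow> (\<forall>R ss. S R = Some ss \<longrightarrow> ss \<noteq> [])"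

type_synonym ('r, 'd) db_fact = "'r \<times> 'd const list"

definition db_instance :: "'r schema \<Rightarrow> ('r, 'd) db_fact set \<Rightarrow> bool" where
  "db_instance S I \<longleftrightarrow> finite I \<and> (\<forall>(R, t) \<in> I. S R = Some (map sort_of t))"

datatype cmp = Eq | Neq | Lt | Le | Gt | Ge

primrec cmp_holds :: "cmp \<Rightarrow> 'd const \<Rightarrow> 'd const \<Rightarrow> bool" where
  "cmp_holds Eq u v \<longleftrightarrow> u = v"
| "cmp_holds Neq u v \<longleftrightarrow> u \<noteq> v"
| "cmp_holds Lt u v \<longleftrightarrow> (\<exists>p q. u = Q p \<and> v = Q q \<and> p < q)"
| "cmp_holds Le u v \<longleftrightarrow> (\<exists>p q. u = Q p \<and> v = Q q \<and> p \<le> q)"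
| "cmp_holds Gt u v \<longleftrightarrow> (\<exists>p q. u = Q p \<and> v = Q q \<and> p > q)"
| "cmp_holds Ge u v \<longleftrightarrow> (\<exists>p q. u = Q p \<and> v = Q q \<and> p \<ge> q)"

datatype 'd tm = Var nat | Const "'d const"

datatype 'd formula =
    Cmp cmp "'d tm" "'d tm"
  | Neg "'d formula"
  | Conj "'d formula" "'d formula"
  | Disj "'d formula" "'d formula"

primrec tm_val :: "(nat \<Rightarrow> 'd const) \<Rightarrow> 'd tm \<Rightarrow> 'd const" where
  "tm_val \<rho> (Var x) = \<rho> x"
| "tm_val \<rho> (Const c) = c"

primrec sat :: "(nat \<Rightarrow> 'd const) \<Rightarrow> 'd formula \<Rightarrow> bool" where
  "sat \<rho> (Cmp r s t) \<longleftrightarrow> cmp_holds r (tm_val \<rho> s) (tm_val \<rho> t)"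
| "sat \<rho> (Neg \<phi>) \<longleftrightarrow> \<not> sat \<rho> \<phi>"
| "sat \<rho> (Conj \<phi> \<psi>) \<longleftrightarrow> sat \<rho> \<phi> \<and> sat \<rho> \<psi>"
| "sat \<rho> (Disj \<phi> \<psi>) \<longleftrightarrow> sat \<rho> \<phi> \<or> sat \<rho> \<psi>"

primrec tm_vars :: "'d tm \<Rightarrow> nat set" where
  "tm_vars (Var x) = {x}"
| "tm_vars (Const c) = {}"

primrec vars :: "'d formula \<Rightarrow> nat set" where
  "vars (Cmp r s t) = tm_vars s \<union> tm_vars t"
| "vars (Neg \<phi>) = vars \<phi>"
| "vars (Conj \<phi> \<psi>) = vars \<phi> \<union> vars \<psi>"
| "vars (Disj \<phi> \<psi>) = vars \<phi> \<union> vars \<psi>"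

primrec tm_sort :: "(nat \<Rightarrow> sort) \<Rightarrow> 'd tm \<Rightarrow> sort" where
  "tm_sort \<Gamma> (Var x) = \<Gamma> x"
| "tm_sort \<Gamma> (Const c) = sort_of c"

primrec well_sorted :: "(nat \<Rightarrow> sort) \<Rightarrow> 'd formula \<Rightarrow> bool" where
  "well_sorted \<Gamma> (Cmp r s t) \<longleftrightarrow>
     tm_sort \<Gamma> s = tm_sort \<Gamma> t \<and> (r \<in> {Eq, Neq} \<or> tm_sort \<Gamma> s = Rational)"
| "well_sorted \<Gamma> (Neg \<phi>) \<longleftrightarrow> well_sorted \<Gamma> \<phi>"
| "well_sorted \<Gamma> (Conj \<phi> \<psi>) \<longleftrightarrow> well_sorted \<Gamma> \<phi> \<and> well_sorted \<Gamma> \<psi>"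
| "well_sorted \<Gamma> (Disj \<phi> \<psi>) \<longleftrightarrow> well_sorted \<Gamma> \<phi> \<and> well_sorted \<Gamma> \<psi>"

(* DC [(R1, xs1), ..., (Rn, xsn)] phi  stands for
   ALL xs. ~ (R1(xs1) & ... & Rn(xsn) & phi(xs)) *)
datatype ('r, 'd) dc = DC (atoms: "('r \<times> nat list) list") (condition: "'d formula")

definition denial_constraint :: "'r schema \<Rightarrow> ('r, 'd) dc \<Rightarrow> bool" where
  "denial_constraint S \<delta> \<longleftrightarrow>
     atoms \<delta> \<noteq> [] \<and>
     vars (condition \<delta>) \<subseteq> (\<Union>(R, xs) \<in> set (atoms \<delta>). set xs) \<and>
     (\<exists>\<Gamma>. (\<forall>(R, xs) \<in> set (atoms \<delta>). S R = Some (map \<Gamma> xs)) \<and> well_sorted \<Gamma> (condition \<delta>))"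


section \<open>Conflicts, repairs and priorities\<close>

definition conflict ::
  "('r, 'd) dc set \<Rightarrow> ('r, 'd) db_fact set \<Rightarrow> ('r, 'd) db_fact set \<Rightarrow> bool" where
  "conflict F I C \<longleftrightarrow> C \<subseteq> I \<and>
     (\<exists>\<delta> \<in> F. \<exists>\<rho>. sat \<rho> (condition \<delta>) \<and> C = (\<lambda>(R, xs). (R, map \<rho> xs)) ` set (atoms \<delta>))"

definition consistent :: "('r, 'd) dc set \<Rightarrow> ('r, 'd) db_fact set \<Rightarrow> bool" where
  "consistent F I \<longleftrightarrow>
     (\<forall>\<delta> \<in> F. \<forall>\<rho>. \<not> ((\<forall>(R, xs) \<in> set (atoms \<delta>). (R, map \<rho> xs) \<in> I) \<and> sat \<rho> (condition \<delta>)))"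

lemma consistent_iff_no_conflict: "consistent F I \<longleftrightarrow> (\<nexists>C. conflict F I C)"
proof -
  have "(\<forall>(R, xs) \<in> A. (R, map \<rho> xs) \<in> I) \<longleftrightarrow> (\<lambda>(R, xs). (R, map \<rho> xs)) ` A \<subseteq> I"
    for \<rho> :: "nat \<Rightarrow> 'b const" and A :: "('a \<times> nat list) set"
    by auto
  then show ?thesis
    unfolding consistent_def conflict_def by metis
qed

definition repair :: "('r, 'd) dc set \<Rightarrow> ('r, 'd) db_fact set \<Rightarrow> ('r, 'd) db_fact set \<Rightarrow> bool" where
  "repair F I I' \<longleftrightarrow> I' \<subseteq> I \<and> consistent F I' \<and> (\<forall>J. I' \<subset> J \<and> J \<subseteq> I \<longrightarrow> \<not> consistent F J)"

definition neighbors ::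
  "('r, 'd) dc set \<Rightarrow> ('r, 'd) db_fact set \<Rightarrow> ('r, 'd) db_fact \<Rightarrow> ('r, 'd) db_fact \<Rightarrow> bool" where
  "neighbors F I x y \<longleftrightarrow> (\<exists>C. conflict F I C \<and> x \<in> C \<and> y \<in> C)"

(* (x, y) \<in> P  means that x has priority over y. *)
definition priority ::
  "('r, 'd) dc set \<Rightarrow> ('r, 'd) db_fact set \<Rightarrow> ('r, 'd) db_fact rel \<Rightarrow> bool" where
  "priority F I P \<longleftrightarrow> P \<subseteq> I \<times> I \<and> acyclic P \<and> (\<forall>(x, y) \<in> P. neighbors F I x y)"

definition improvement ::
  "('r, 'd) dc set \<Rightarrow> ('r, 'd) db_fact set \<Rightarrow> ('r, 'd) db_fact rel \<Rightarrow> ('r, 'd) db_fact set \<Rightarrow>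
   ('r, 'd) db_fact set \<Rightarrow> ('r, 'd) db_fact set \<Rightarrow> bool" where
  "improvement F I P I' X Y \<longleftrightarrow>
     X \<noteq> {} \<and> X \<subseteq> I' \<and> Y \<subseteq> I - I' \<and> (\<forall>x \<in> X. \<exists>y \<in> Y. (y, x) \<in> P) \<and>
     consistent F ((I' - X) \<union> Y)"

definition globally_optimal ::
  "('r, 'd) dc set \<Rightarrow> ('r, 'd) db_fact set \<Rightarrow> ('r, 'd) db_fact rel \<Rightarrow> ('r, 'd) db_fact set \<Rightarrow> bool" where
  "globally_optimal F I P I' \<longleftrightarrow> I' \<subseteq> I \<and> (\<nexists>X Y. improvement F I P I' X Y)"


section \<open>The algorithm GlobalRepair\<close>

(* Control states:  Extending J R  is the basic repairing loop with current set J and facts R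
   still to be considered;  Loop I'  is the head of the while loop;  Returned I'  is final.
   The type of the collections is a parameter, so that the states of the implementation below
   (over lists) are mapped to the states of the algorithm (over sets) by  map_state set. *)
datatype 'a state = Extending 'a 'a | Loop 'a | Returned 'a

inductive gr_step ::
  "('r, 'd) dc set \<Rightarrow> ('r, 'd) db_fact set \<Rightarrow> ('r, 'd) db_fact rel \<Rightarrow>
   ('r, 'd) db_fact set state \<Rightarrow> ('r, 'd) db_fact set state \<Rightarrow> bool"
  for F I P where
  consider_add: "f \<in> R \<Longrightarrow> consistent F (insert f J) \<Longrightarrow>
     gr_step F I P (Extending J R) (Extending (insert f J) (R - {f}))"
| consider_discard: "f \<in> R \<Longrightarrow> \<not> consistent F (insert f J) \<Longrightarrow>
     gr_step F I P (Extending J R) (Extending J (R - {f}))"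
| extended: "gr_step F I P (Extending J {}) (Loop J)"
| improve: "improvement F I P I' X Y \<Longrightarrow> J = (I' - X) \<union> Y \<Longrightarrow>
     gr_step F I P (Loop I') (Extending J (I - J))"
| finish: "\<nexists>X Y. improvement F I P I' X Y \<Longrightarrow>
     gr_step F I P (Loop I') (Returned I')"

definition gr_init :: "('r, 'd) db_fact set \<Rightarrow> ('r, 'd) db_fact set state" where
  "gr_init I = Extending {} I"

definition gr_reaches ::
  "('r, 'd) dc set \<Rightarrow> ('r, 'd) db_fact set \<Rightarrow> ('r, 'd) db_fact rel \<Rightarrow>
   ('r, 'd) db_fact set state \<Rightarrow> bool" where
  "gr_reaches F I P s \<longleftrightarrow> (gr_step F I P)\<^sup>*\<^sup>* (gr_init I) s"

(* Every run ends, and it ends by returning a set. *)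
definition gr_terminates ::
  "('r, 'd) dc set \<Rightarrow> ('r, 'd) db_fact set \<Rightarrow> ('r, 'd) db_fact rel \<Rightarrow> bool" where
  "gr_terminates F I P \<longleftrightarrow>
     (\<nexists>r. r 0 = gr_init I \<and> (\<forall>i::nat. gr_step F I P (r i) (r (Suc i)))) \<and>
     (\<forall>s. gr_reaches F I P s \<and> (\<nexists>s'. gr_step F I P s s') \<longrightarrow> (\<exists>I'. s = Returned I'))"


section \<open>Running time\<close>

text \<open>
  Time is measured on an implementation of the algorithm over lists, written in a monad that pairs
  a result with the time spent. Each \<open>ret\<close> and each sequencing step costs one unit; comparing two
  constants or relation names costs as much as an implementation on their binary codes. The guard of
  the while loop is decided by exhaustive search. The nondeterministic choices of the algorithm
  remain choices of the implementation.

  The parameters \<open>rlen\<close> and \<open>dlen\<close> are the code lengths of relation names and of uninterpreted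
  constants.
\<close>

type_synonym 'a timed = "'a \<times> nat"

definition ret :: "'a \<Rightarrow> 'a timed" where
  "ret x = (x, 1)"

definition bindT :: "'a timed \<Rightarrow> ('a \<Rightarrow> 'b timed) \<Rightarrow> 'b timed"  (infixl "\<bind>" 54) where
  "m \<bind> k = (fst (k (fst m)), snd m + snd (k (fst m)) + 1)"

primrec any_t :: "('a \<Rightarrow> bool timed) \<Rightarrow> 'a list \<Rightarrow> bool timed" where
  "any_t p [] = ret False"
| "any_t p (x # xs) = p x \<bind> (\<lambda>b. if b then ret True else any_t p xs)"

primrec all_t :: "('a \<Rightarrow> bool timed) \<Rightarrow> 'a list \<Rightarrow> bool timed" where
  "all_t p [] = ret True"
| "all_t p (x # xs) = p x \<bind> (\<lambda>b. if b then all_t p xs else ret False)"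

primrec filter_t :: "('a \<Rightarrow> bool timed) \<Rightarrow> 'a list \<Rightarrow> 'a list timed" where
  "filter_t p [] = ret []"
| "filter_t p (x # xs) =
     p x \<bind> (\<lambda>b. filter_t p xs \<bind> (\<lambda>ys. ret (if b then x # ys else ys)))"

primrec map_t :: "('a \<Rightarrow> 'b timed) \<Rightarrow> 'a list \<Rightarrow> 'b list timed" where
  "map_t g [] = ret []"
| "map_t g (x # xs) = g x \<bind> (\<lambda>y. map_t g xs \<bind> (\<lambda>ys. ret (y # ys)))"

primrec append_t :: "'a list \<Rightarrow> 'a list \<Rightarrow> 'a list timed" where
  "append_t [] ys = ret ys"
| "append_t (x # xs) ys = append_t xs ys \<bind> (\<lambda>zs. ret (x # zs))"

primrec length_t :: "'a list \<Rightarrow> nat timed" where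
  "length_t [] = ret 0"
| "length_t (x # xs) = length_t xs \<bind> (\<lambda>n. ret (Suc n))"

primrec subs_t :: "'a list \<Rightarrow> 'a list list timed" where
  "subs_t [] = ret [[]]"
| "subs_t (x # xs) =
     subs_t xs \<bind> (\<lambda>yss. map_t (\<lambda>ys. ret (x # ys)) yss \<bind> (\<lambda>zss. append_t zss yss))"

primrec product_t :: "'a list \<Rightarrow> 'b list \<Rightarrow> ('a \<times> 'b) list timed" where
  "product_t [] ys = ret []"
| "product_t (x # xs) ys =
     map_t (\<lambda>y. ret (x, y)) ys \<bind> (\<lambda>ps. product_t xs ys \<bind> (\<lambda>qs. append_t ps qs))"

primrec lookup_t :: "nat \<Rightarrow> (nat \<times> 'b) list \<Rightarrow> 'b option timed" where
  "lookup_t x [] = ret None"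
| "lookup_t x (p # ps) = (if fst p = x then ret (Some (snd p)) else ret () \<bind> (\<lambda>_. lookup_t x ps))"

primrec tm_val_t :: "(nat \<times> 'd const) list \<Rightarrow> 'd tm \<Rightarrow> 'd const option timed" where
  "tm_val_t env (Var x) = lookup_t x env"
| "tm_val_t env (Const c) = ret (Some c)"

definition rat_len :: "rat \<Rightarrow> nat" where
  "rat_len q = (case quotient_of q of (a, b) \<Rightarrow> nat (bitlen \<bar>a\<bar> + bitlen b))"

context
  fixes rlen :: "'r \<Rightarrow> nat" and dlen :: "'d \<Rightarrow> nat"
begin

primrec const_len :: "'d const \<Rightarrow> nat" where
  "const_len (Q q) = 1 + rat_len q"
| "const_len (D d) = 1 + dlen d"

definition fact_len :: "('r, 'd) db_fact \<Rightarrow> nat" where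
  "fact_len f = 1 + rlen (fst f) + sum_list (map const_len (snd f))"

definition input_size :: "('r, 'd) db_fact set \<Rightarrow> ('r, 'd) db_fact rel \<Rightarrow> nat" where
  "input_size I P = (\<Sum>f\<in>I. fact_len f) + (\<Sum>(f, g)\<in>P. fact_len f + fact_len g)"

(* Quadratic because comparing a/b with c/d amounts to comparing a*d with c*b, and schoolbook
   multiplication takes quadratic time. *)
definition cmp_t :: "cmp \<Rightarrow> 'd const \<Rightarrow> 'd const \<Rightarrow> bool timed" where
  "cmp_t r u v = (cmp_holds r u v, (const_len u + const_len v)\<^sup>2)"

definition name_eq_t :: "'r \<Rightarrow> 'r \<Rightarrow> bool timed" where
  "name_eq_t R R' = (R = R', 1 + rlen R + rlen R')"

primrec tuple_eq_t :: "'d const list \<Rightarrow> 'd const list \<Rightarrow> bool timed" where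
  "tuple_eq_t [] vs = ret (vs = [])"
| "tuple_eq_t (u # us) vs = (case vs of
       [] \<Rightarrow> ret False
     | w # ws \<Rightarrow> cmp_t Eq u w \<bind> (\<lambda>b. if b then tuple_eq_t us ws else ret False))"

definition fact_eq_t :: "('r, 'd) db_fact \<Rightarrow> ('r, 'd) db_fact \<Rightarrow> bool timed" where
  "fact_eq_t f g =
     name_eq_t (fst f) (fst g) \<bind> (\<lambda>b. if b then tuple_eq_t (snd f) (snd g) else ret False)"

definition member_t :: "('r, 'd) db_fact \<Rightarrow> ('r, 'd) db_fact list \<Rightarrow> bool timed" where
  "member_t f gs = any_t (fact_eq_t f) gs"

definition diff_t ::
  "('r, 'd) db_fact list \<Rightarrow> ('r, 'd) db_fact list \<Rightarrow> ('r, 'd) db_fact list timed" where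
  "diff_t fs gs = filter_t (\<lambda>f. member_t f gs \<bind> (\<lambda>b. ret (\<not> b))) fs"

primrec remove_t ::
  "('r, 'd) db_fact \<Rightarrow> ('r, 'd) db_fact list \<Rightarrow> ('r, 'd) db_fact list timed" where
  "remove_t f [] = ret []"
| "remove_t f (g # gs) = fact_eq_t f g \<bind>
     (\<lambda>b. if b then ret gs else remove_t f gs \<bind> (\<lambda>hs. ret (g # hs)))"

primrec sat_t :: "(nat \<times> 'd const) list \<Rightarrow> 'd formula \<Rightarrow> bool timed" where
  "sat_t env (Cmp r s t) = tm_val_t env s \<bind> (\<lambda>u. tm_val_t env t \<bind> (\<lambda>v.
     case (u, v) of (Some c, Some d) \<Rightarrow> cmp_t r c d | _ \<Rightarrow> ret False))"
| "sat_t env (Neg \<phi>) = sat_t env \<phi> \<bind> (\<lambda>b. ret (\<not> b))"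
| "sat_t env (Conj \<phi> \<psi>) = sat_t env \<phi> \<bind> (\<lambda>b. sat_t env \<psi> \<bind> (\<lambda>c. ret (b \<and> c)))"
| "sat_t env (Disj \<phi> \<psi>) = sat_t env \<phi> \<bind> (\<lambda>b. sat_t env \<psi> \<bind> (\<lambda>c. ret (b \<or> c)))"

(* Matching an atom against a fact extends the current partial substitution, or fails. *)
primrec match_args_t ::
  "nat list \<Rightarrow> 'd const list \<Rightarrow> (nat \<times> 'd const) list \<Rightarrow> (nat \<times> 'd const) list option timed"
  where
  "match_args_t [] vs env = ret (if vs = [] then Some env else None)"
| "match_args_t (x # xs) vs env = (case vs of
       [] \<Rightarrow> ret None
     | w # ws \<Rightarrow> lookup_t x env \<bind> (\<lambda>u. case u of
           None \<Rightarrow> match_args_t xs ws ((x, w) # env)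
         | Some c \<Rightarrow> cmp_t Eq c w \<bind> (\<lambda>b. if b then match_args_t xs ws env else ret None)))"

definition match_atom_t ::
  "'r \<times> nat list \<Rightarrow> ('r, 'd) db_fact \<Rightarrow> (nat \<times> 'd const) list \<Rightarrow>
   (nat \<times> 'd const) list option timed" where
  "match_atom_t a f env = name_eq_t (fst a) (fst f) \<bind>
     (\<lambda>b. if b then match_args_t (snd a) (snd f) env else ret None)"

primrec violates_t ::
  "('r \<times> nat list) list \<Rightarrow> 'd formula \<Rightarrow> ('r, 'd) db_fact list \<Rightarrow> (nat \<times> 'd const) list \<Rightarrow>
   bool timed" where
  "violates_t [] \<phi> J env = sat_t env \<phi>"
| "violates_t (a # as) \<phi> J env = any_t (\<lambda>f. match_atom_t a f env \<bind>
     (\<lambda>e. case e of None \<Rightarrow> ret False | Some env' \<Rightarrow> violates_t as \<phi> J env')) J"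

definition consistent_t :: "('r, 'd) dc list \<Rightarrow> ('r, 'd) db_fact list \<Rightarrow> bool timed" where
  "consistent_t F J = any_t (\<lambda>\<delta>. violates_t (atoms \<delta>) (condition \<delta>) J []) F \<bind> (\<lambda>b. ret (\<not> b))"

definition prefers_t ::
  "(('r, 'd) db_fact \<times> ('r, 'd) db_fact) list \<Rightarrow> ('r, 'd) db_fact \<Rightarrow> ('r, 'd) db_fact \<Rightarrow>
   bool timed" where
  "prefers_t P y x = any_t (\<lambda>p. fact_eq_t y (fst p) \<bind>
     (\<lambda>b. if b then fact_eq_t x (snd p) else ret False)) P"

definition replace_t ::
  "('r, 'd) db_fact list \<Rightarrow> ('r, 'd) db_fact list \<Rightarrow> ('r, 'd) db_fact list \<Rightarrow>
   ('r, 'd) db_fact list timed" where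
  "replace_t I' X Y = diff_t I' X \<bind> (\<lambda>K. append_t K Y)"

definition improvement_t ::
  "('r, 'd) dc list \<Rightarrow> (('r, 'd) db_fact \<times> ('r, 'd) db_fact) list \<Rightarrow> ('r, 'd) db_fact list \<Rightarrow>
   ('r, 'd) db_fact list \<Rightarrow> ('r, 'd) db_fact list \<Rightarrow> bool timed" where
  "improvement_t F P I' X Y =
     (if X = [] then ret False
      else all_t (\<lambda>x. any_t (\<lambda>y. prefers_t P y x) Y) X \<bind>
        (\<lambda>b. if b then replace_t I' X Y \<bind> (\<lambda>J. consistent_t F J) else ret False))"

definition improvements_t ::
  "('r, 'd) dc list \<Rightarrow> ('r, 'd) db_fact list \<Rightarrow> (('r, 'd) db_fact \<times> ('r, 'd) db_fact) list \<Rightarrow>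
   ('r, 'd) db_fact list \<Rightarrow> (('r, 'd) db_fact list \<times> ('r, 'd) db_fact list) list timed" where
  "improvements_t F I P I' =
     subs_t I' \<bind> (\<lambda>Xs. diff_t I I' \<bind> (\<lambda>K. subs_t K \<bind> (\<lambda>Ys. product_t Xs Ys \<bind>
       (\<lambda>ps. filter_t (\<lambda>p. improvement_t F P I' (fst p) (snd p)) ps))))"

definition consider_t ::
  "('r, 'd) dc list \<Rightarrow> ('r, 'd) db_fact list \<Rightarrow> ('r, 'd) db_fact list \<Rightarrow> ('r, 'd) db_fact \<Rightarrow>
   ('r, 'd) db_fact list state timed" where
  "consider_t F J R f = consistent_t F (f # J) \<bind> (\<lambda>b. remove_t f R \<bind>
     (\<lambda>R'. ret (Extending (if b then f # J else J) R')))"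

definition improve_t ::
  "('r, 'd) db_fact list \<Rightarrow> ('r, 'd) db_fact list \<Rightarrow> ('r, 'd) db_fact list \<Rightarrow>
   ('r, 'd) db_fact list \<Rightarrow> ('r, 'd) db_fact list state timed" where
  "improve_t I I' X Y =
     replace_t I' X Y \<bind> (\<lambda>J. diff_t I J \<bind> (\<lambda>R. ret (Extending J R)))"

(* exec_step F I P s t s' : one step of the implementation from s to s', taking time t.
   Choosing an element of a list is charged the traversal of that list, for a fact f of R
   within remove_t f R. *)
inductive exec_step ::
  "('r, 'd) dc list \<Rightarrow> ('r, 'd) db_fact list \<Rightarrow> (('r, 'd) db_fact \<times> ('r, 'd) db_fact) list \<Rightarrow>
   ('r, 'd) db_fact list state \<Rightarrow> nat \<Rightarrow> ('r, 'd) db_fact list state \<Rightarrow> bool"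
  for F I P where
  "f \<in> set R \<Longrightarrow> consider_t F J R f = (s, t) \<Longrightarrow> exec_step F I P (Extending J R) t s"
| "exec_step F I P (Extending J []) 1 (Loop J)"
| "improvements_t F I P I' = (ps, t) \<Longrightarrow> (X, Y) \<in> set ps \<Longrightarrow> improve_t I I' X Y = (s, u) \<Longrightarrow>
     exec_step F I P (Loop I') (t + snd (length_t ps) + u) s"
| "improvements_t F I P I' = ([], t) \<Longrightarrow> exec_step F I P (Loop I') (t + 1) (Returned I')"

inductive exec ::
  "('r, 'd) dc list \<Rightarrow> ('r, 'd) db_fact list \<Rightarrow> (('r, 'd) db_fact \<times> ('r, 'd) db_fact) list \<Rightarrow>
   ('r, 'd) db_fact list state \<Rightarrow> nat \<Rightarrow> ('r, 'd) db_fact list state \<Rightarrow> bool"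
  for F I P where
  "exec F I P s 0 s"
| "exec_step F I P s t s' \<Longrightarrow> exec F I P s' u s'' \<Longrightarrow> exec F I P s (t + u) s''"

end

definition exec_init :: "('r, 'd) db_fact list \<Rightarrow> ('r, 'd) db_fact list state" where
  "exec_init I = Extending [] I"

(* The steps of the implementation from s are exactly those of the algorithm. *)
definition implements_at ::
  "('r \<Rightarrow> nat) \<Rightarrow> ('d \<Rightarrow> nat) \<Rightarrow>
   ('r, 'd) dc list \<Rightarrow> ('r, 'd) db_fact list \<Rightarrow> (('r, 'd) db_fact \<times> ('r, 'd) db_fact) list \<Rightarrow>
   ('r, 'd) db_fact list state \<Rightarrow> bool" where
  "implements_at rlen dlen F I P s \<longleftrightarrow>
     (\<forall>a. gr_step (set F) (set I) (set P) (map_state set s) a \<longleftrightarrow>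
          (\<exists>t s'. exec_step rlen dlen F I P s t s' \<and> map_state set s' = a))"

end

theory Submission
  imports Defs
begin

text \<open>
  Extend the priority to a total order and give the fact of rank \<open>i\<close> the weight \<open>2 ^ i\<close>. An
  improvement removes only facts that are dominated by an added fact, so the largest fact concerned
  is an added one and the total weight of the repair increases; extending to a repair increases it
  further. Hence the loop is entered at most \<open>2 ^ card I\<close> times, and it is left exactly at a
  globally optimal repair. Conversely, any repair is the result of the first phase when its own
  facts are considered first. A single step searches at most \<open>4 ^ card I\<close> pairs, each in time
  polynomial in the input.
\<close>

section \<open>The abstract algorithm\<close>

text \<open>Powers of two are used because a single added fact may replace any number of facts of
  lower rank, so counting facts would not give a potential.

  Two models have to be tied together: invariants and measure live on sets, the clock on lists. The
  link is made state by state: at every list state that a run can reach, the list steps are the set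
  steps up to \<open>set\<close>. The measure on sets therefore also counts the steps of each run of
  the implementation, complete or partial.

  The time bound needs one exponent for all inputs. Every cost is stated as a power of a single
  number \<open>M \<ge> 2\<close>; sums, products and the constants of the constraints are absorbed
  into the exponent, which then depends only on \<open>F\<close> and the code lengths. The choice
  \<open>M = 2 ^ (size + 1)\<close> bounds facts, lists and numbers of subsets alike, and a fixed
  power of it is exponential in the input. Exponents are merely added up, never optimised.\<close>

lemma consistent_subset: "consistent F K" if "consistent F J" "K \<subseteq> J"
proof -
  have "\<forall>(R, xs)\<in>A. (R, map \<rho> xs) \<in> J" if "\<forall>(R, xs)\<in>A. (R, map \<rho> xs) \<in> K"
    for A :: "('a \<times> nat list) set" and \<rho> :: "nat \<Rightarrow> 'b const"
    using that \<open>K \<subseteq> J\<close> by auto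
  then show ?thesis
    using that(1) unfolding consistent_def by metis
qed

text \<open>Consistency passes to subsets, so any larger consistent set already yields a consistent
  extension by one fact. This one-fact test is what the extension loop performs.\<close>

lemma repair_iff:
  "repair F I J \<longleftrightarrow> J \<subseteq> I \<and> consistent F J \<and> (\<forall>f \<in> I - J. \<not> consistent F (insert f J))"
    (is "_ \<longleftrightarrow> ?r")
proof
  assume "repair F I J"
  then have J: "J \<subseteq> I" "consistent F J"
    and max: "\<And>K. J \<subset> K \<Longrightarrow> K \<subseteq> I \<Longrightarrow> \<not> consistent F K"
    unfolding repair_def by blast+
  have "\<not> consistent F (insert f J)" if "f \<in> I - J" for f
    using max[of "insert f J"] J(1) that by blast
  then show ?r
    using J by blast
next
  assume r: ?r
  have "\<not> consistent F K" if K: "J \<subset> K" "K \<subseteq> I" for K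
  proof -
    obtain f where "f \<in> K" "f \<notin> J"
      using K by blast
    then have "f \<in> I - J" "insert f J \<subseteq> K"
      using that by auto
    then show ?thesis
      using r consistent_subset by blast
  qed
  then show "repair F I J"
    using r unfolding repair_def by blast
qed

section \<open>Ranking an acyclic priority and weighing sets of facts\<close>

lemma finite_acyclic_ranking:
  assumes "finite A" "acyclic P"
  shows "\<exists>r::'a \<Rightarrow> nat. inj_on r A \<and> r ` A \<subseteq> {..<card A} \<and>
           (\<forall>(y, x) \<in> P. y \<in> A \<longrightarrow> x \<in> A \<longrightarrow> r x < r y)"
  using assms(1)
proof (induction A rule: finite_remove_induct)
  case empty
  then show ?case by auto
next
  case (remove A)
  \<comment> \<open>\<open>P\<close> may be infinite; its restriction to \<open>A\<close> is finite,
    so acyclicity makes it well-founded. A minimal element \<open>a\<close> is one that nothing in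
    \<open>A\<close> dominates, and it takes the top rank.\<close>
  define Q where "Q = P \<inter> A \<times> A"
  have "finite Q" "acyclic Q"
    using remove.hyps acyclic_subset[OF assms(2), of Q] by (auto simp: Q_def)
  then have "wf Q"
    by (rule finite_acyclic_wf)
  then obtain a where a: "a \<in> A" "\<And>y. (y, a) \<in> Q \<Longrightarrow> y \<notin> A"
    using \<open>A \<noteq> {}\<close> by (metis wfE_min ex_in_conv)
  obtain r :: "'a \<Rightarrow> nat" where r: "inj_on r (A - {a})" "r ` (A - {a}) \<subseteq> {..<card (A - {a})}"
    "\<forall>(y, x) \<in> P. y \<in> A - {a} \<longrightarrow> x \<in> A - {a} \<longrightarrow> r x < r y"
    using remove.IH a(1) by blast
  define n where "n = card (A - {a})"
  have n: "card A = Suc n"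
    using a(1) remove.hyps(1) by (metis card_Suc_Diff1 n_def)
  define r' where "r' x = (if x = a then n else r x)" for x
  have lt: "r x < n" if "x \<in> A" "x \<noteq> a" for x
    using r(2) that n_def by blast
  have "inj_on r' A"
    using r(1) lt by (auto simp: inj_on_def r'_def)
  moreover have "r' ` A \<subseteq> {..<card A}"
    using lt less_SucI by (fastforce simp: r'_def n)
  moreover have "r' x < r' y" if "(y, x) \<in> P" "y \<in> A" "x \<in> A" for y x
    using that a(2)[of y] r(3) lt[of x] by (auto simp: r'_def Q_def)
  ultimately show ?case by blast
qed

text \<open>For injective \<open>r\<close> this is the number whose binary digits mark the ranks
  occurring in \<open>J\<close>: one fact outweighs all facts of smaller rank together.\<close>

definition weight :: "('a \<Rightarrow> nat) \<Rightarrow> 'a set \<Rightarrow> nat" where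
  "weight r J = (\<Sum>f\<in>J. 2 ^ r f)"

text \<open>Distinct powers of two below \<open>2 ^ n\<close> sum to at most
  \<open>2 ^ n - 1\<close>. With \<open>n\<close> the top rank of the added facts this compares the
  two sides of an improvement; with \<open>n\<close> the number of facts it caps the
  potential.\<close>

lemma weight_less:
  assumes "finite J" "inj_on r J" "r ` J \<subseteq> {..<n}"
  shows "weight r J < 2 ^ n"
proof -
  have "weight r J = (\<Sum>i\<in>r ` J. 2 ^ i)"
    using assms(2) by (simp add: weight_def sum.reindex)
  also have "\<dots> \<le> (\<Sum>i<n. 2 ^ i)"
    using assms(3) by (intro sum_mono2) auto
  also have "\<dots> = 2 ^ n - 1"
    using sum_power2[of n] by (simp add: atLeast0LessThan)
  also have "\<dots> < 2 ^ n"
    by simp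
  finally show ?thesis .
qed

lemma weight_mono: "weight r J \<le> weight r K" if "finite K" "J \<subseteq> K"
  using that unfolding weight_def by (intro sum_mono2) auto

lemma improvement_weight:
  assumes "finite I" "inj_on r I"
    and mono: "\<forall>(y, x) \<in> P. y \<in> I \<longrightarrow> x \<in> I \<longrightarrow> r x < r y"
    and "I' \<subseteq> I" and imp: "improvement F I P I' X Y"
  shows "weight r I' < weight r ((I' - X) \<union> Y)"
proof -
  have XY: "X \<noteq> {}" "X \<subseteq> I'" "Y \<subseteq> I - I'" "\<forall>x \<in> X. \<exists>y \<in> Y. (y, x) \<in> P"
    using imp by (auto simp: improvement_def)
  have fin: "finite I'" "finite X" "finite Y"
    using assms(1,4) XY(2,3) by (blast intro: finite_subset)+
  have "Y \<noteq> {}"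
    using XY by auto
  define m where "m = Max (r ` Y)"
  have "m \<in> r ` Y"
    using \<open>Y \<noteq> {}\<close> fin(3) unfolding m_def by (intro Max_in) auto
  then obtain y where y: "y \<in> Y" "r y = m" by auto
  have "r x < m" if x: "x \<in> X" for x
  proof -
    obtain z where z: "z \<in> Y" "(z, x) \<in> P"
      using XY(4) x by blast
    then have "z \<in> I" "x \<in> I"
      using XY(2,3) assms(4) x by auto
    then have "r x < r z"
      using mono z(2) by auto
    also have "\<dots> \<le> m"
      using z fin(3) by (simp add: m_def)
    finally show ?thesis .
  qed
  moreover have "inj_on r X"
    using assms(2,4) XY(2) by (meson inj_on_subset subset_trans)
  ultimately have "weight r X < 2 ^ m"
    using fin(2) by (intro weight_less) auto
  also have "2 ^ m = weight r {y}"
    by (simp add: weight_def y)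
  also have "\<dots> \<le> weight r Y"
    using fin(3) y(1) by (intro weight_mono) auto
  finally have *: "weight r X < weight r Y" .
  have "weight r I' = weight r (I' - X) + weight r X"
    unfolding weight_def using fin(1) XY(2) by (simp add: sum.subset_diff)
  moreover have "weight r ((I' - X) \<union> Y) = weight r (I' - X) + weight r Y"
    unfolding weight_def using fin XY(3) by (intro sum.union_disjoint) auto
  ultimately show ?thesis
    using * by simp
qed

section \<open>Invariant and termination measure\<close>

fun gr_invariant ::
  "('r, 'd) dc set \<Rightarrow> ('r, 'd) db_fact set \<Rightarrow> ('r, 'd) db_fact rel \<Rightarrow>
   ('r, 'd) db_fact set state \<Rightarrow> bool" where
  "gr_invariant F I P (Extending J R) \<longleftrightarrow> J \<subseteq> I \<and> R \<subseteq> I \<and> consistent F J \<and>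
     (\<forall>f \<in> I - J - R. \<not> consistent F (insert f J))"
| "gr_invariant F I P (Loop J) \<longleftrightarrow> repair F I J"
| "gr_invariant F I P (Returned J) \<longleftrightarrow> repair F I J \<and> globally_optimal F I P J"

text \<open>The last clause for \<open>Extending\<close> records that the facts no longer queued
  were rightly left out. It survives the growth of \<open>J\<close>, because a conflict stays a
  conflict, and with \<open>R\<close> empty it is maximality. Right after an improvement it is
  vacuous, as everything outside \<open>J\<close> is queued again.\<close>

lemma gr_step_invariant:
  assumes "gr_step F I P s s'" "gr_invariant F I P s"
  shows "gr_invariant F I P s'"
  using assms
proof cases
  case (consider_add f R J)
  moreover have "consistent F (insert g J)" if "consistent F (insert g (insert f J))" for g
    using consistent_subset[OF that] by blast
  ultimately show ?thesis
    using assms(2) by simp blast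
next
  case (improve I' X Y J)
  then show ?thesis
    using assms(2) by (auto simp: improvement_def repair_def)
qed (auto simp: repair_iff globally_optimal_def)

lemma gr_invariant_init:
  assumes "\<forall>\<delta> \<in> F. denial_constraint S \<delta>"
  shows "gr_invariant F I P (gr_init I)"
proof -
  \<comment> \<open>A constraint without atoms could be violated by the empty instance, where the
    algorithm starts.\<close>
  have "\<forall>\<delta> \<in> F. atoms \<delta> \<noteq> []"
    using assms by (simp add: denial_constraint_def)
  then have "consistent F {}"
    by (fastforce simp: consistent_def neq_Nil_conv)
  then show ?thesis
    by (simp add: gr_init_def)
qed

text \<open>
  The factor \<^term>\<open>n + 3\<close> outweighs the facts that an improvement queues for the next extension.
\<close>

fun gr_measure :: "nat \<Rightarrow> ('a \<Rightarrow> nat) \<Rightarrow> 'a set state \<Rightarrow> nat" where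
  "gr_measure n r (Extending J R) = (2 ^ n - weight r J) * (n + 3) + card R + 2"
| "gr_measure n r (Loop J) = (2 ^ n - weight r J) * (n + 3) + 1"
| "gr_measure n r (Returned J) = 0"

lemma gr_step_measure:
  assumes "finite I" "inj_on r I" "r ` I \<subseteq> {..<card I}"
    and mono: "\<forall>(y, x) \<in> P. y \<in> I \<longrightarrow> x \<in> I \<longrightarrow> r x < r y"
    and inv: "gr_invariant F I P s" and step: "gr_step F I P s s'"
  shows "gr_measure (card I) r s' < gr_measure (card I) r s"
  using step
proof cases
  case (consider_add f R J)
  have fin: "finite R" "finite J"
    using inv consider_add finite_subset[OF _ assms(1)] by auto
  \<comment> \<open>Not strict, since the invariant allows \<open>f\<close> to lie in
    \<open>J\<close> already; the strict decrease comes from \<open>R\<close>.\<close>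
  have "(2 ^ card I - weight r (insert f J)) * (card I + 3) \<le> (2 ^ card I - weight r J) * (card I + 3)"
    using fin by (intro mult_right_mono diff_le_mono2 weight_mono) auto
  moreover have "card (R - {f}) < card R"
    by (rule card_Diff1_less[OF fin(1) consider_add(3)])
  ultimately show ?thesis
    unfolding consider_add(1,2) gr_measure.simps by linarith
next
  case (consider_discard f R J)
  have "finite R"
    using inv consider_discard finite_subset[OF _ assms(1)] by auto
  then have "card (R - {f}) < card R"
    by (rule card_Diff1_less[OF _ consider_discard(3)])
  then show ?thesis
    using consider_discard by simp
next
  case (improve I' X Y J)
  have I': "I' \<subseteq> I"
    using inv improve by (simp add: repair_def)
  then have J: "J \<subseteq> I"
    using improve by (auto simp: improvement_def)
  have "weight r I' < weight r J"
    using improvement_weight[OF assms(1,2) mono I'] improve by simp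
  \<comment> \<open>Subtraction on naturals truncates: without this bound a gain in weight need not
    lower the difference.\<close>
  moreover have "weight r J < 2 ^ card I"
    using J assms(1-3) finite_subset inj_on_subset by (intro weight_less) (auto, blast+)
  ultimately have "Suc (2 ^ card I - weight r J) \<le> 2 ^ card I - weight r I'"
    by simp
  then have "Suc (2 ^ card I - weight r J) * (card I + 3) \<le> (2 ^ card I - weight r I') * (card I + 3)"
    by (rule mult_right_mono) simp
  \<comment> \<open>One unit of weight releases \<open>card I + 3\<close>, which pays for the at
    most \<open>card I\<close> queued facts and for the offset 2 of \<open>Extending\<close> in
    place of 1.\<close>
  moreover have "card (I - J) \<le> card I"
    using assms(1) by (simp add: card_mono)
  ultimately show ?thesis
    using improve by simp
qed auto

lemma gr_terminates:
  assumes "finite I" "priority F I P" and dc: "\<forall>\<delta> \<in> F. denial_constraint S \<delta>"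
  shows "gr_terminates F I P"
proof -
  obtain r :: "_ \<Rightarrow> nat" where r: "inj_on r I" "r ` I \<subseteq> {..<card I}"
    "\<forall>(y, x) \<in> P. y \<in> I \<longrightarrow> x \<in> I \<longrightarrow> r x < r y"
    using finite_acyclic_ranking[OF assms(1)] assms(2) unfolding priority_def by meson
  have False if "q 0 = gr_init I" and q: "\<forall>i::nat. gr_step F I P (q i) (q (Suc i))" for q
  proof -
    have inv: "gr_invariant F I P (q i)" for i
      by (induction i) (use that gr_invariant_init[OF dc] in \<open>auto intro: gr_step_invariant\<close>)
    have "gr_measure (card I) r (q (Suc i)) < gr_measure (card I) r (q i)" for i
      using gr_step_measure[OF assms(1) r inv] q by blast
    then have "\<exists>m. \<forall>i::nat. (m (Suc i), m i) \<in> less_than"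
      by (intro exI[of _ "\<lambda>i. gr_measure (card I) r (q i)"]) simp
    then show False
      using wf_less_than by (simp add: wf_iff_no_infinite_down_chain)
  qed
  moreover have "\<exists>I'. s = Returned I'" if "\<nexists>s'. gr_step F I P s s'" for s
  proof (cases s)
    case (Extending J R)
    then show ?thesis
      using that by (cases "R = {}") (auto intro: gr_step.intros)
  next
    case (Loop J)
    then show ?thesis
      using that by (meson gr_step.improve gr_step.finish)
  qed auto
  ultimately show ?thesis
    unfolding gr_terminates_def by blast
qed

text \<open>A consistent set is built by considering its own facts first.\<close>

lemma gr_steps_add:
  assumes "finite K" "K \<subseteq> R" "consistent F (J \<union> K)"
  shows "(gr_step F I P)\<^sup>*\<^sup>* (Extending J R) (Extending (J \<union> K) (R - K))"
  using assms
proof (induction K rule: finite_induct)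
  case (insert f K)
  then have "consistent F (J \<union> K)"
    using consistent_subset[of F "J \<union> insert f K"] by blast
  then have "(gr_step F I P)\<^sup>*\<^sup>* (Extending J R) (Extending (J \<union> K) (R - K))"
    using insert by simp
  moreover have "gr_step F I P (Extending (J \<union> K) (R - K))
      (Extending (insert f (J \<union> K)) (R - K - {f}))"
    using insert by (intro consider_add) auto
  moreover have "insert f (J \<union> K) = J \<union> insert f K" "R - K - {f} = R - insert f K"
    by auto
  ultimately show ?case
    by (metis rtranclp.rtrancl_into_rtrancl)
qed simp

lemma gr_steps_discard:
  assumes "finite R" "\<forall>f \<in> R. \<not> consistent F (insert f J)"
  shows "(gr_step F I P)\<^sup>*\<^sup>* (Extending J R) (Extending J {})"
  using assms
proof (induction R rule: finite_induct)
  case (insert f R)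
  then have "gr_step F I P (Extending J (insert f R)) (Extending J (insert f R - {f}))"
    by (intro consider_discard) auto
  then show ?case
    using insert by (auto intro: converse_rtranclp_into_rtranclp)
qed simp

text \<open>Soundness is the invariant at the final state. Completeness needs no iteration: the
  first phase builds the given repair, maximality discards the rest, and global optimality lets the
  loop be left at once.\<close>

lemma gr_reaches_Returned_iff:
  assumes "finite I" and dc: "\<forall>\<delta> \<in> F. denial_constraint S \<delta>"
  shows "gr_reaches F I P (Returned I') \<longleftrightarrow> repair F I I' \<and> globally_optimal F I P I'"
proof
  assume "gr_reaches F I P (Returned I')"
  then have "(gr_step F I P)\<^sup>*\<^sup>* (gr_init I) (Returned I')"
    by (simp add: gr_reaches_def)
  then have "gr_invariant F I P (Returned I')"
    by (induction rule: rtranclp_induct) (use gr_invariant_init[OF dc] gr_step_invariant in auto)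
  then show "repair F I I' \<and> globally_optimal F I P I'"
    by simp
next
  assume I': "repair F I I' \<and> globally_optimal F I P I'"
  then have "I' \<subseteq> I" "consistent F I'" "\<forall>f \<in> I - I'. \<not> consistent F (insert f I')"
    by (auto simp: repair_iff)
  moreover have "finite I'"
    using assms(1) \<open>I' \<subseteq> I\<close> finite_subset by blast
  ultimately have "(gr_step F I P)\<^sup>*\<^sup>* (gr_init I) (Extending I' (I - I'))"
    using gr_steps_add[of I' I F "{}" I P] by (simp add: gr_init_def)
  also have "(gr_step F I P)\<^sup>*\<^sup>* (Extending I' (I - I')) (Extending I' {})"
    using gr_steps_discard assms(1) \<open>\<forall>f \<in> I - I'. _\<close> by blast
  also have "gr_step F I P (Extending I' {}) (Loop I')"
    by (rule extended)
  also have "gr_step F I P (Loop I') (Returned I')"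
    using I' by (intro finish) (simp add: globally_optimal_def)
  finally show "gr_reaches F I P (Returned I')"
    by (simp add: gr_reaches_def)
qed

section \<open>Correctness of the implementation\<close>

lemma fst_ret [simp]: "fst (ret x) = x"
  by (simp add: ret_def)

lemma fst_bindT [simp]: "fst (m \<bind> k) = fst (k (fst m))"
  by (simp add: bindT_def)

lemma fst_any_t [simp]: "fst (any_t p xs) \<longleftrightarrow> (\<exists>x \<in> set xs. fst (p x))"
  by (induction xs) auto

lemma fst_all_t [simp]: "fst (all_t p xs) \<longleftrightarrow> (\<forall>x \<in> set xs. fst (p x))"
  by (induction xs) auto

lemma fst_filter_t [simp]: "fst (filter_t p xs) = filter (\<lambda>x. fst (p x)) xs"
  by (induction xs) auto

lemma fst_map_t [simp]: "fst (map_t g xs) = map (\<lambda>x. fst (g x)) xs"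
  by (induction xs) auto

lemma fst_append_t [simp]: "fst (append_t xs ys) = xs @ ys"
  by (induction xs) auto

lemma fst_subs_t [simp]: "fst (subs_t xs) = subseqs xs"
  by (induction xs) (auto simp: Let_def)

lemma fst_product_t [simp]: "fst (product_t xs ys) = List.product xs ys"
  by (induction xs) auto

lemma fst_lookup_t [simp]: "fst (lookup_t x env) = map_of env x"
  by (induction env) auto

lemma fst_cmp_t [simp]: "fst (cmp_t dlen r u v) = cmp_holds r u v"
  by (simp add: cmp_t_def)

lemma fst_tuple_eq_t [simp]: "fst (tuple_eq_t dlen us vs) \<longleftrightarrow> us = vs"
  by (induction us arbitrary: vs) (auto split: list.splits)

lemma fst_fact_eq_t [simp]: "fst (fact_eq_t rlen dlen f g) \<longleftrightarrow> f = g"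
  by (auto simp: fact_eq_t_def name_eq_t_def prod_eq_iff)

lemma fst_member_t [simp]: "fst (member_t rlen dlen f gs) \<longleftrightarrow> f \<in> set gs"
  by (auto simp: member_t_def)

lemma fst_diff_t [simp]: "fst (diff_t rlen dlen fs gs) = filter (\<lambda>f. f \<notin> set gs) fs"
  by (simp add: diff_t_def)

lemma fst_remove_t [simp]: "fst (remove_t rlen dlen f gs) = remove1 f gs"
  by (induction gs) auto

lemma fst_prefers_t [simp]: "fst (prefers_t rlen dlen P y x) \<longleftrightarrow> (y, x) \<in> set P"
  by (force simp: prefers_t_def)

lemma fst_replace_t [simp]:
  "fst (replace_t rlen dlen I' X Y) = filter (\<lambda>f. f \<notin> set X) I' @ Y"
  by (simp add: replace_t_def)

section \<open>Partial substitutions and the search for conflicts\<close>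

definition agrees :: "(nat \<Rightarrow> 'a) \<Rightarrow> (nat \<times> 'a) list \<Rightarrow> bool" where
  "agrees \<rho> env \<longleftrightarrow> (\<forall>x v. map_of env x = Some v \<longrightarrow> \<rho> x = v)"

lemma agrees_Nil [simp]: "agrees \<rho> []"
  by (simp add: agrees_def)

lemma agrees_Cons: "map_of env x = None \<Longrightarrow> agrees \<rho> ((x, v) # env) \<longleftrightarrow> \<rho> x = v \<and> agrees \<rho> env"
  by (auto simp: agrees_def)

lemma agreesD: "agrees \<rho> env \<Longrightarrow> map_of env x = Some v \<Longrightarrow> \<rho> x = v"
  by (simp add: agrees_def)

lemma ex_agrees: "\<exists>\<rho>. agrees \<rho> env"
  by (intro exI[of _ "\<lambda>x. the (map_of env x)"]) (simp add: agrees_def)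

lemma fst_tm_val_t:
  assumes "agrees \<rho> env" "tm_vars s \<subseteq> fst ` set env"
  shows "fst (tm_val_t env s) = Some (tm_val \<rho> s)"
proof (cases s)
  case (Var x)
  then have "x \<in> fst ` set env"
    using assms(2) by simp
  then obtain v where "map_of env x = Some v"
    by (metis map_of_eq_None_iff not_None_eq)
  then show ?thesis
    using Var agreesD[OF assms(1)] by simp
qed simp

lemma fst_sat_t:
  assumes "agrees \<rho> env" "vars \<phi> \<subseteq> fst ` set env"
  shows "fst (sat_t dlen env \<phi>) \<longleftrightarrow> sat \<rho> \<phi>"
  using assms(2) by (induction \<phi>) (simp_all add: fst_tm_val_t[OF assms(1)])

lemma match_args_t_None:
  assumes "fst (match_args_t dlen xs vs env) = None" "agrees \<rho> env"
  shows "map \<rho> xs \<noteq> vs"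
  using assms
proof (induction xs arbitrary: vs env)
  case (Cons x xs)
  then show ?case
    by (auto split: list.splits option.splits if_splits simp: agrees_Cons dest: agreesD)
qed (auto split: if_splits)

text \<open>Matching loses no substitution: the total extensions of \<open>env'\<close> are those of
  \<open>env\<close> that send \<open>xs\<close> to \<open>vs\<close>. The domain equation serves to
  show that conditions are evaluated on bound variables; the last two clauses serve the time
  bounds.\<close>

lemma match_args_t_Some:
  assumes "fst (match_args_t dlen xs vs env) = Some env'"
  shows "agrees \<rho> env' \<longleftrightarrow> agrees \<rho> env \<and> map \<rho> xs = vs"
    and "fst ` set env' = fst ` set env \<union> set xs"
    and "snd ` set env' \<subseteq> snd ` set env \<union> set vs"
    and "length env' \<le> length env + length xs"
proof -
  have "(agrees \<rho> env' \<longleftrightarrow> agrees \<rho> env \<and> map \<rho> xs = vs) \<and>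
    fst ` set env' = fst ` set env \<union> set xs \<and>
    snd ` set env' \<subseteq> snd ` set env \<union> set vs \<and> length env' \<le> length env + length xs"
    using assms
  proof (induction xs arbitrary: vs env)
    case (Cons x xs)
    then obtain w ws where vs: "vs = w # ws"
      by (cases vs) auto
    show ?case
    proof (cases "map_of env x")
      case None
      then have "fst (match_args_t dlen xs ws ((x, w) # env)) = Some env'"
        using Cons.prems vs by simp
      from Cons.IH[OF this] show ?thesis
        using None vs by (auto simp: agrees_Cons)
    next
      case (Some c)
      then have "c = w" "fst (match_args_t dlen xs ws env) = Some env'"
        using Cons.prems vs by (auto split: if_splits)
      moreover have "x \<in> fst ` set env"
        using Some map_of_SomeD by force
      \<comment> \<open>A repeated variable has its value fixed by \<open>env\<close>, so the
        equation for \<open>x\<close> can be added freely.\<close>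
      moreover have "agrees \<rho> env \<longleftrightarrow> agrees \<rho> env \<and> \<rho> x = c"
        using Some agreesD by fast
      ultimately show ?thesis
        using Cons.IH[of ws env] unfolding vs by (simp add: insert_absorb) blast
    qed
  qed (auto split: if_splits)
  then show "agrees \<rho> env' \<longleftrightarrow> agrees \<rho> env \<and> map \<rho> xs = vs"
    and "fst ` set env' = fst ` set env \<union> set xs"
    and "snd ` set env' \<subseteq> snd ` set env \<union> set vs"
    and "length env' \<le> length env + length xs"
    by blast+
qed

lemma fst_match_atom_t:
  "fst (match_atom_t rlen dlen a f env) =
     (if fst a = fst f then fst (match_args_t dlen (snd a) (snd f) env) else None)"
  by (simp add: match_atom_t_def name_eq_t_def)

lemma match_atom_t_None:
  assumes "fst (match_atom_t rlen dlen a f env) = None" "agrees \<rho> env"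
  shows "(fst a, map \<rho> (snd a)) \<noteq> f"
  using assms match_args_t_None[of dlen "snd a" "snd f" env \<rho>]
  by (cases f) (auto simp: fst_match_atom_t split: if_splits)

lemma match_atom_t_Some:
  assumes "fst (match_atom_t rlen dlen a f env) = Some env'"
  shows "agrees \<rho> env' \<longleftrightarrow> agrees \<rho> env \<and> (fst a, map \<rho> (snd a)) = f"
    and "fst ` set env' = fst ` set env \<union> set (snd a)"
    and "snd ` set env' \<subseteq> snd ` set env \<union> set (snd f)"
    and "length env' \<le> length env + length (snd a)"
  using assms match_args_t_Some[of dlen "snd a" "snd f" env env']
  by (auto simp: fst_match_atom_t prod_eq_iff split: if_splits)

text \<open>The hypothesis is the safety of a denial constraint in the middle of the search: each
  variable of the condition is bound or occurs in an atom still to be matched. At the leaf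
  \<open>env\<close> alone decides the condition, with the same outcome for every
  \<open>\<rho>\<close> that agrees with it, and \<open>ex_agrees\<close> supplies one.\<close>

lemma fst_violates_t:
  assumes "vars \<phi> \<subseteq> fst ` set env \<union> (\<Union>a \<in> set as. set (snd a))"
  shows "fst (violates_t rlen dlen as \<phi> J env) \<longleftrightarrow>
    (\<exists>\<rho>. agrees \<rho> env \<and> (\<forall>a \<in> set as. (fst a, map \<rho> (snd a)) \<in> set J) \<and> sat \<rho> \<phi>)"
  using assms
proof (induction as arbitrary: env)
  case Nil
  then show ?case
    using ex_agrees[of env] fst_sat_t[of _ env \<phi> dlen] by auto
next
  case (Cons a as)
  define Q where "Q \<rho> \<longleftrightarrow> (\<forall>a \<in> set as. (fst a, map \<rho> (snd a)) \<in> set J) \<and> sat \<rho> \<phi>" for \<rho>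
  have "(case fst (match_atom_t rlen dlen a f env) of
           None \<Rightarrow> False | Some env' \<Rightarrow> fst (violates_t rlen dlen as \<phi> J env')) \<longleftrightarrow>
        (\<exists>\<rho>. agrees \<rho> env \<and> (fst a, map \<rho> (snd a)) = f \<and> Q \<rho>)" for f
  proof (cases "fst (match_atom_t rlen dlen a f env)")
    case None
    then show ?thesis
      using match_atom_t_None[OF None] by auto
  next
    case (Some env')
    note m = match_atom_t_Some[OF Some]
    have "vars \<phi> \<subseteq> fst ` set env' \<union> (\<Union>a \<in> set as. set (snd a))"
      using Cons.prems m(2) by auto
    from Cons.IH[OF this] show ?thesis
      using Some m(1) by (auto simp: Q_def)
  qed
  then have "fst (violates_t rlen dlen (a # as) \<phi> J env) \<longleftrightarrow>
      (\<exists>f \<in> set J. \<exists>\<rho>. agrees \<rho> env \<and> (fst a, map \<rho> (snd a)) = f \<and> Q \<rho>)"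
    by (simp add: option.case_distrib[where h = fst] cong: option.case_cong)
  then show ?case
    by (auto simp: Q_def)
qed

lemma fst_consistent_t:
  assumes "\<forall>\<delta> \<in> set F. denial_constraint S \<delta>"
  shows "fst (consistent_t rlen dlen F J) \<longleftrightarrow> consistent (set F) (set J)"
proof -
  have "fst (violates_t rlen dlen (atoms \<delta>) (condition \<delta>) J []) \<longleftrightarrow>
    (\<exists>\<rho>. (\<forall>(R, xs) \<in> set (atoms \<delta>). (R, map \<rho> xs) \<in> set J) \<and> sat \<rho> (condition \<delta>))"
    if "\<delta> \<in> set F" for \<delta>
    using assms that
    by (subst fst_violates_t) (auto simp: denial_constraint_def case_prod_beta)
  then show ?thesis
    by (auto simp: consistent_t_def consistent_def)
qed

section \<open>Exhaustive search for improvements\<close>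

lemma fst_improvement_t:
  assumes "\<forall>\<delta> \<in> set F. denial_constraint S \<delta>" "set X \<subseteq> set I'" "set Y \<subseteq> set I - set I'"
  shows "fst (improvement_t rlen dlen F P I' X Y) \<longleftrightarrow>
    improvement (set F) (set I) (set P) (set I') (set X) (set Y)"
proof -
  have "set I' - set X \<union> set Y = set (filter (\<lambda>f. f \<notin> set X) I' @ Y)"
    by auto
  then show ?thesis
    using assms(2,3) fst_consistent_t[OF assms(1), of rlen dlen "filter (\<lambda>f. f \<notin> set X) I' @ Y"]
    by (auto simp: improvement_t_def improvement_def)
qed

text \<open>\<open>improvement_t\<close> does not test the inclusions required of \<open>X\<close>
  and \<open>Y\<close>; the search guarantees them by drawing \<open>X\<close> from
  \<open>I'\<close> and \<open>Y\<close> from the facts outside \<open>I'\<close>.\<close>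

lemma fst_improvements_t:
  assumes "\<forall>\<delta> \<in> set F. denial_constraint S \<delta>"
  shows "set (fst (improvements_t rlen dlen F I P I')) =
    {(X, Y). X \<in> set (subseqs I') \<and> Y \<in> set (subseqs (filter (\<lambda>f. f \<notin> set I') I)) \<and>
       improvement (set F) (set I) (set P) (set I') (set X) (set Y)}"
proof -
  have "set Z \<subseteq> set zs" if "Z \<in> set (subseqs zs)" for Z zs :: "('a, 'b) db_fact list"
    using that subseqs_powset[of zs] by blast
  then have "set X \<subseteq> set I'" "set Y \<subseteq> set I - set I'"
    if "X \<in> set (subseqs I')" "Y \<in> set (subseqs (filter (\<lambda>f. f \<notin> set I') I))" for X Y
    using that by fastforce+
  then show ?thesis
    using fst_improvement_t[OF assms, of _ I' _ I rlen dlen P]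
    by (auto simp: improvements_t_def)
qed

text \<open>Subsequences realize all subsets, so no improvement is missed. In particular the search
  returns the empty list exactly when the loop must stop.\<close>

lemma improvements_t_abstract:
  assumes "\<forall>\<delta> \<in> set F. denial_constraint S \<delta>"
  shows "(\<lambda>(X, Y). (set X, set Y)) ` set (fst (improvements_t rlen dlen F I P I')) =
    {(X, Y). improvement (set F) (set I) (set P) (set I') X Y}"
proof -
  have sub: "\<exists>Z \<in> set (subseqs zs). set Z = A" if "A \<subseteq> set zs"
    for A and zs :: "('a, 'b) db_fact list"
  proof -
    have "A \<in> set ` set (subseqs zs)"
      using that by (simp add: subseqs_powset)
    then show ?thesis by auto
  qed
  have "\<exists>X' \<in> set (subseqs I'). \<exists>Y' \<in> set (subseqs (filter (\<lambda>f. f \<notin> set I') I)).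
      set X' = X \<and> set Y' = Y"
    if "improvement (set F) (set I) (set P) (set I') X Y" for X Y
  proof -
    have "X \<subseteq> set I'" "Y \<subseteq> set (filter (\<lambda>f. f \<notin> set I') I)"
      using that by (auto simp: improvement_def)
    from sub[OF this(1)] sub[OF this(2)] show ?thesis
      by blast
  qed
  then show ?thesis
    unfolding fst_improvements_t[OF assms] by (fastforce simp: image_iff)
qed

section \<open>Correspondence between steps on lists and steps on sets\<close>

fun list_invariant :: "'a list state \<Rightarrow> bool" where
  "list_invariant (Extending J R) \<longleftrightarrow> distinct J \<and> distinct R \<and> set J \<inter> set R = {}"
| "list_invariant (Loop J) \<longleftrightarrow> distinct J"
| "list_invariant (Returned J) \<longleftrightarrow> distinct J"

text \<open>Both sides offer the same choices, up to the order in which a set is listed.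
  Distinctness matters for \<open>remove_t\<close>, which deletes one copy only and has to act as
  set difference.\<close>

lemma implements_at:
  fixes F :: "('r, 'd) dc list"
  assumes "\<forall>\<delta> \<in> set F. denial_constraint S \<delta>" "list_invariant s"
  shows "implements_at rlen dlen F I P s"
  unfolding implements_at_def
proof (intro allI iffI)
  note [simp] = fst_consistent_t[OF assms(1)]
  fix a
  assume "gr_step (set F) (set I) (set P) (map_state set s) a"
  then show "\<exists>t s'. exec_step rlen dlen F I P s t s' \<and> map_state set s' = a"
  proof cases
    case (consider_add f R' J')
    then obtain J R where s: "s = Extending J R" "R' = set R" "J' = set J"
      by (cases s) auto
    moreover have "exec_step rlen dlen F I P (Extending J R)
        (snd (consider_t rlen dlen F J R f)) (fst (consider_t rlen dlen F J R f))"
      using consider_add s by (intro exec_step.intros(1)) auto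
    moreover have "map_state set (fst (consider_t rlen dlen F J R f)) = a"
      using consider_add s assms(2) by (auto simp: consider_t_def)
    ultimately show ?thesis by blast
  next
    case (consider_discard f R' J')
    then obtain J R where s: "s = Extending J R" "R' = set R" "J' = set J"
      by (cases s) auto
    moreover have "exec_step rlen dlen F I P (Extending J R)
        (snd (consider_t rlen dlen F J R f)) (fst (consider_t rlen dlen F J R f))"
      using consider_discard s by (intro exec_step.intros(1)) auto
    moreover have "map_state set (fst (consider_t rlen dlen F J R f)) = a"
      using consider_discard s assms(2) by (auto simp: consider_t_def)
    ultimately show ?thesis by blast
  next
    case (extended J')
    then obtain J where s: "s = Extending J []" "J' = set J"
      by (cases s) auto
    then show ?thesis
      using extended exec_step.intros(2)[of rlen dlen F I P J] by fastforce
  next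
    case (improve I'' X' Y' J')
    then obtain I' where s: "s = Loop I'" "I'' = set I'"
      by (cases s) auto
    have "(X', Y') \<in> (\<lambda>(X, Y). (set X, set Y)) ` set (fst (improvements_t rlen dlen F I P I'))"
      unfolding improvements_t_abstract[OF assms(1)] using improve s by simp
    then obtain X Y where XY: "(X, Y) \<in> set (fst (improvements_t rlen dlen F I P I'))"
      "X' = set X" "Y' = set Y"
      by auto
    then have "\<exists>t. exec_step rlen dlen F I P s t (fst (improve_t rlen dlen I I' X Y))"
      using exec_step.intros(3)[OF prod.collapse[symmetric] _ prod.collapse[symmetric]] s by blast
    moreover have "map_state set (fst (improve_t rlen dlen I I' X Y)) = a"
      using improve s XY by (auto simp: improve_t_def)
    ultimately show ?thesis by blast
  next
    case (finish I'')
    then obtain I' where s: "s = Loop I'" "I'' = set I'"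
      by (cases s) auto
    have "fst (improvements_t rlen dlen F I P I') = []"
      using improvements_t_abstract[OF assms(1), of rlen dlen I P I'] finish s by auto
    then have "\<exists>t. exec_step rlen dlen F I P s t (Returned I')"
      using exec_step.intros(4) s by (metis prod.collapse)
    moreover have "map_state set (Returned I') = a"
      using finish s by simp
    ultimately show ?thesis by blast
  qed
next
  note [simp] = fst_consistent_t[OF assms(1)]
  fix a
  assume "\<exists>t s'. exec_step rlen dlen F I P s t s' \<and> map_state set s' = a"
  then obtain t s' where "exec_step rlen dlen F I P s t s'" and a: "map_state set s' = a"
    by blast
  then show "gr_step (set F) (set I) (set P) (map_state set s) a"
  proof cases
    case (1 f R J)
    then have "s' = fst (consider_t rlen dlen F J R f)"
      by simp
    then show ?thesis
      using 1 a assms(2) consider_add[of f "set R" "set F" "set J" "set I" "set P"]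
        consider_discard[of f "set R" "set F" "set J" "set I" "set P"]
      by (auto simp: consider_t_def split: if_splits)
  next
    case (2 J)
    then show ?thesis
      using a gr_step.extended by auto
  next
    case (3 I' ps t X Y u)
    then have "(set X, set Y) \<in> {(X, Y). improvement (set F) (set I) (set P) (set I') X Y}"
      unfolding improvements_t_abstract[OF assms(1), of rlen dlen I P I', symmetric] by force
    moreover have "s' = fst (improve_t rlen dlen I I' X Y)"
      using 3 by simp
    ultimately show ?thesis
      using 3 a gr_step.improve[of "set F" "set I" "set P" "set I'" "set X" "set Y"]
      by (auto simp: improve_t_def set_diff_eq)
  next
    case (4 I' t)
    then have "{(X, Y). improvement (set F) (set I) (set P) (set I') X Y} = {}"
      unfolding improvements_t_abstract[OF assms(1), of rlen dlen I P I', symmetric] by force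
    then show ?thesis
      using 4 a gr_step.finish[of "set F" "set I" "set P" "set I'"] by auto
  qed
qed

text \<open>No duplicates arise: a queued fact is not yet in \<open>J\<close>, and the facts
  \<open>Y\<close> of an improvement lie outside \<open>I'\<close> and come from the duplicate-free
  list \<open>I\<close>.\<close>

lemma exec_step_list_invariant:
  assumes dc: "\<forall>\<delta> \<in> set F. denial_constraint S \<delta>" and "distinct I"
    and "exec_step rlen dlen F I P s t s'" "list_invariant s"
  shows "list_invariant s'"
  using assms(3)
proof cases
  case (1 f R J)
  then have "s' = fst (consider_t rlen dlen F J R f)"
    by simp
  then show ?thesis
    using 1 assms(4) by (auto simp: consider_t_def)
next
  case (3 I' ps t X Y u)
  then have "(X, Y) \<in> set (fst (improvements_t rlen dlen F I P I'))"
    by simp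
  then have XY: "X \<in> set (subseqs I')" "Y \<in> set (subseqs (filter (\<lambda>f. f \<notin> set I') I))"
    "set Y \<inter> set I' = {}"
    unfolding fst_improvements_t[OF dc] by (auto simp: improvement_def)
  have "distinct Y"
    by (rule subseqs_distinctD[OF XY(2)]) (simp add: assms(2))
  moreover have "s' = fst (improve_t rlen dlen I I' X Y)"
    using 3 by simp
  ultimately show ?thesis
    using 3 assms(2,4) XY(3) by (auto simp: improve_t_def)
qed (use assms(4) in auto)

section \<open>Running time\<close>

context
  fixes M :: nat
  assumes M: "2 \<le> M"
begin

lemma le_power_weaken: "a \<le> M ^ i \<Longrightarrow> i \<le> j \<Longrightarrow> a \<le> M ^ j"
  using M by (meson le_trans power_increasing one_le_numeral)

lemma le_power_self: "k \<le> M ^ k"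
proof -
  have "k \<le> 2 ^ k"
    by (simp add: less_imp_le)
  also have "(2::nat) ^ k \<le> M ^ k"
    using M by (rule power_mono) simp
  finally show ?thesis .
qed

lemma le_power_mult: "a \<le> M ^ i \<Longrightarrow> b \<le> M ^ j \<Longrightarrow> a * b \<le> M ^ (i + j)"
  by (simp add: power_add mult_le_mono)

text \<open>As the base is at least 2, one extra factor absorbs a sum. Together with
  \<open>le_power_mult\<close> and \<open>le_power_self\<close> this makes powers of
  \<open>M\<close> closed under all that a cost is built from, so no coefficients have to be carried
  along.\<close>

lemma le_power_add:
  assumes "a \<le> M ^ i" "b \<le> M ^ j"
  shows "a + b \<le> M ^ (i + j + 1)"
proof -
  have "a + b \<le> M ^ (i + j) + M ^ (i + j)"
    using assms by (intro add_mono) (auto elim: le_power_weaken)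
  also have "\<dots> \<le> M ^ (i + j + 1)"
    using M by (simp add: mult_2[symmetric])
  finally show ?thesis .
qed

lemma snd_ret_le: "snd (ret x) \<le> M ^ i"
  using M by (simp add: ret_def)

lemma snd_bindT_le:
  assumes "snd m \<le> M ^ i" "snd (k (fst m)) \<le> M ^ j"
  shows "snd (m \<bind> k) \<le> M ^ (i + j + 2)"
proof -
  \<comment> \<open>One of the two extra factors is for the sum, the other for the unit charged by
    sequencing.\<close>
  have "snd m + snd (k (fst m)) + 1 \<le> M ^ ((i + j + 1) + 0 + 1)"
    using assms M by (intro le_power_add) auto
  then show ?thesis
    by (simp add: bindT_def)
qed

text \<open>The cost of a pass over \<open>n\<close> items: \<open>T\<close> for an item, at most 3
  for the sequencing and returning around it, and 1 for the empty list. The added exponent comes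
  from \<open>8 \<le> M ^ 3\<close>.\<close>

lemma pass_le:
  assumes "n \<le> M ^ i" "T \<le> M ^ j"
  shows "n * (T + 3) + 1 \<le> M ^ (i + j + 3)"
proof -
  have "1 \<le> M ^ i" "1 \<le> M ^ j"
    using M by auto
  have "n * (T + 3) \<le> M ^ i * (4 * M ^ j)"
    using assms \<open>1 \<le> M ^ j\<close> by (intro mult_le_mono) auto
  also have "\<dots> = 4 * M ^ (i + j)"
    by (simp add: power_add)
  finally have "n * (T + 3) + 1 \<le> 4 * M ^ (i + j) + 1"
    by simp
  also have "\<dots> \<le> 8 * M ^ (i + j)"
    using one_le_power[of M "i + j"] M by simp
  also have "\<dots> \<le> M ^ 3 * M ^ (i + j)"
    using power_mono[OF M, of 3] by (intro mult_le_mono) auto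
  finally show ?thesis
    by (simp add: power_add mult_ac)
qed

lemma snd_any_t_le:
  assumes "\<And>x. x \<in> set xs \<Longrightarrow> snd (p x) \<le> M ^ j" "length xs \<le> M ^ i"
  shows "snd (any_t p xs) \<le> M ^ (i + j + 3)"
proof -
  have "snd (any_t p xs) \<le> length xs * (M ^ j + 3) + 1"
    using assms(1) by (induction xs) (fastforce simp: ret_def bindT_def)+
  also note pass_le[OF assms(2) order_refl]
  finally show ?thesis .
qed

lemma snd_all_t_le:
  assumes "\<And>x. x \<in> set xs \<Longrightarrow> snd (p x) \<le> M ^ j" "length xs \<le> M ^ i"
  shows "snd (all_t p xs) \<le> M ^ (i + j + 3)"
proof -
  have "snd (all_t p xs) \<le> length xs * (M ^ j + 3) + 1"
    using assms(1) by (induction xs) (fastforce simp: ret_def bindT_def)+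
  also note pass_le[OF assms(2) order_refl]
  finally show ?thesis .
qed

lemma snd_filter_t_le:
  assumes "\<And>x. x \<in> set xs \<Longrightarrow> snd (p x) \<le> M ^ j" "length xs \<le> M ^ i"
  shows "snd (filter_t p xs) \<le> M ^ (i + j + 3)"
proof -
  have "snd (filter_t p xs) \<le> length xs * (M ^ j + 3) + 1"
    using assms(1) by (induction xs) (fastforce simp: ret_def bindT_def)+
  also note pass_le[OF assms(2) order_refl]
  finally show ?thesis .
qed

end

section \<open>Costs of the generic list operations\<close>

lemma snd_ret: "snd (ret x) = 1"
  by (simp add: ret_def)

lemma snd_append_t: "snd (append_t xs ys) = 2 * length xs + 1"
  by (induction xs) (auto simp: bindT_def snd_ret)

lemma snd_length_t: "snd (length_t xs) = 2 * length xs + 1"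
  by (induction xs) (auto simp: bindT_def snd_ret)

lemma snd_map_ret: "snd (map_t (\<lambda>x. ret (g x)) xs) = 4 * length xs + 1"
  by (induction xs) (auto simp: bindT_def snd_ret)

text \<open>The factor 10 is the least \<open>K\<close> with \<open>K + 6 + 4 \<le> 2 * K\<close>,
  where 6 and 4 come from the recurrence and the 4 is inflated to
  \<open>4 * 2 ^ length xs\<close>.\<close>

lemma snd_subs_t: "snd (subs_t xs) \<le> 10 * 2 ^ length xs"
proof (induction xs)
  case (Cons x xs)
  have "snd (subs_t (x # xs)) = snd (subs_t xs) + 6 * 2 ^ length xs + 4"
    by (simp add: bindT_def snd_ret snd_append_t snd_map_ret length_subseqs)
  also have "\<dots> \<le> 10 * 2 ^ length xs + 6 * 2 ^ length xs + 4 * 2 ^ length xs"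
    using Cons by (intro add_mono) auto
  finally show ?case by simp
qed (simp add: snd_ret)

lemma snd_product_t: "snd (product_t xs ys) = length xs * (6 * length ys + 4) + 1"
  by (induction xs) (auto simp: bindT_def snd_ret snd_append_t snd_map_ret)

lemma snd_lookup_t: "snd (lookup_t x env) \<le> 2 * length env + 1"
  by (induction env) (auto simp: bindT_def snd_ret)

lemma subseqs_length: "ys \<in> set (subseqs xs) \<Longrightarrow> length ys \<le> length xs"
  by (induction xs arbitrary: ys) (auto simp: Let_def intro: le_SucI)

lemma subseqs_subset: "ys \<in> set (subseqs xs) \<Longrightarrow> set ys \<subseteq> set xs"
  using subseqs_powset[of xs] by blast

section \<open>Sizes of facts and costs of the operations on them\<close>

definition facts_bounded ::
  "('r \<Rightarrow> nat) \<Rightarrow> ('d \<Rightarrow> nat) \<Rightarrow> nat \<Rightarrow> ('r, 'd) db_fact set \<Rightarrow> bool" where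
  "facts_bounded rlen dlen M A \<longleftrightarrow> (\<forall>f \<in> A. fact_len rlen dlen f \<le> M)"

text \<open>Values in an environment come from facts, hence the plain bound \<open>M\<close>; the
  length has its own exponent \<open>e\<close>, because each matched atom may add bindings.\<close>

definition env_bounded :: "('d \<Rightarrow> nat) \<Rightarrow> nat \<Rightarrow> nat \<Rightarrow> (nat \<times> 'd const) list \<Rightarrow> bool" where
  "env_bounded dlen M e env \<longleftrightarrow>
     length env \<le> M ^ e \<and> (\<forall>u \<in> snd ` set env. const_len dlen u \<le> M)"

lemma facts_bounded_subset: "facts_bounded rlen dlen M A \<Longrightarrow> B \<subseteq> A \<Longrightarrow> facts_bounded rlen dlen M B"
  by (auto simp: facts_bounded_def)

text \<open>The 1 in \<open>fact_len\<close> makes the first bound strict, which pays for the 1 in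
  the cost of comparing names. Every constant has length at least 1, so the size also bounds the
  arity.\<close>

lemma fact_len_bounds:
  assumes "fact_len rlen dlen f \<le> M"
  shows "rlen (fst f) < M" and "length (snd f) \<le> M"
    and "\<And>u. u \<in> set (snd f) \<Longrightarrow> const_len dlen u \<le> M"
proof -
  have sum: "1 + rlen (fst f) + sum_list (map (const_len dlen) (snd f)) \<le> M"
    using assms by (simp add: fact_len_def)
  then show "rlen (fst f) < M" by simp
  have one: "1 \<le> const_len dlen u" for u
    by (cases u) auto
  have "length us \<le> sum_list (map (const_len dlen) us)" for us
  proof (induction us)
    case (Cons u us)
    then show ?case
      using one[of u] by simp
  qed simp
  then show "length (snd f) \<le> M"
    using sum by (metis add_leE le_trans)
  show "const_len dlen u \<le> M" if "u \<in> set (snd f)" for u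
    using sum member_le_sum_list[of "const_len dlen u" "map (const_len dlen) (snd f)"] that
    by simp
qed

context
  fixes M :: nat and rlen :: "'r \<Rightarrow> nat" and dlen :: "'d \<Rightarrow> nat"
  assumes M: "2 \<le> M"
begin

lemma snd_cmp_t_le:
  assumes "const_len dlen u \<le> M ^ i" "const_len dlen v \<le> M ^ j"
  shows "snd (cmp_t dlen r u v) \<le> M ^ (2 * (i + j + 1))"
proof -
  have "(const_len dlen u + const_len dlen v)\<^sup>2 \<le> (M ^ (i + j + 1))\<^sup>2"
    using le_power_add[OF M assms] by (rule power_mono) simp
  also have "\<dots> = M ^ (2 * (i + j + 1))"
    by (simp only: power_mult[symmetric] mult.commute)
  finally show ?thesis
    by (simp add: cmp_t_def)
qed

lemma snd_tuple_eq_t_le: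
  assumes "\<And>u. u \<in> set us \<union> set vs \<Longrightarrow> const_len dlen u \<le> M" "length us \<le> M"
  shows "snd (tuple_eq_t dlen us vs) \<le> M ^ 10"
proof -
  \<comment> \<open>Here 6 is \<open>2 * (1 + 1 + 1)\<close>, from \<open>snd_cmp_t_le\<close> for
    two constants of length at most \<open>M\<close>.\<close>
  have "snd (tuple_eq_t dlen us vs) \<le> length us * (M ^ 6 + 3) + 1"
    using assms(1)
  proof (induction us arbitrary: vs)
    case (Cons u us)
    show ?case
    proof (cases vs)
      case (Cons w ws)
      then have "snd (cmp_t dlen Eq u w) \<le> M ^ 6"
        using snd_cmp_t_le[of u 1 w 1 Eq] Cons.prems by simp
      moreover have "snd (tuple_eq_t dlen us ws) \<le> length us * (M ^ 6 + 3) + 1"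
        using Cons Cons.IH Cons.prems by simp
      ultimately show ?thesis
        using Cons by (auto simp: bindT_def ret_def)
    qed (simp add: ret_def)
  qed (simp add: ret_def)
  also have "\<dots> \<le> M ^ (1 + 6 + 3)"
    using assms(2) by (intro pass_le[OF M]) auto
  finally show ?thesis by simp
qed

text \<open>\<open>R\<close> stands for a relation name in a constraint, whose length
  \<open>M\<close> does not bound; being fixed, this length may go into the exponent.\<close>

lemma snd_name_eq_t_le: "rlen R' < M \<Longrightarrow> snd (name_eq_t rlen R R') \<le> M ^ (2 + rlen R)"
proof -
  assume "rlen R' < M"
  then have "(rlen R' + 1) + rlen R \<le> M ^ (1 + rlen R + 1)"
    by (intro le_power_add[OF M] le_power_self[OF M]) auto
  then show ?thesis
    by (simp add: name_eq_t_def)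
qed

lemma snd_fact_eq_t_le:
  assumes "fact_len rlen dlen f \<le> M" "fact_len rlen dlen g \<le> M"
  shows "snd (fact_eq_t rlen dlen f g) \<le> M ^ 14"
proof -
  have "rlen (fst f) + (1 + rlen (fst g)) \<le> M ^ (1 + 1)"
  proof -
    have "rlen (fst f) + (1 + rlen (fst g)) \<le> 2 * M"
      using fact_len_bounds(1)[OF assms(1)] fact_len_bounds(1)[OF assms(2)] by linarith
    also have "\<dots> \<le> M * M"
      using M by simp
    finally show ?thesis by (simp add: power2_eq_square)
  qed
  then have "snd (name_eq_t rlen (fst f) (fst g)) \<le> M ^ 2"
    by (simp add: name_eq_t_def numeral_2_eq_2)
  moreover have "snd (tuple_eq_t dlen (snd f) (snd g)) \<le> M ^ 10"
    using fact_len_bounds(2,3) assms by (intro snd_tuple_eq_t_le) blast+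
  ultimately have "snd (fact_eq_t rlen dlen f g) \<le> M ^ (2 + 10 + 2)"
    unfolding fact_eq_t_def by (intro snd_bindT_le[OF M]) (auto intro: snd_ret_le[OF M])
  then show ?thesis by simp
qed

text \<open>The list is allowed length \<open>M ^ 2\<close> because a replacement is only known to
  have length at most \<open>2 * M\<close>.\<close>

lemma snd_member_t_le:
  assumes "fact_len rlen dlen f \<le> M" "facts_bounded rlen dlen M (set gs)" "length gs \<le> M ^ 2"
  shows "snd (member_t rlen dlen f gs) \<le> M ^ 19"
proof -
  have "snd (member_t rlen dlen f gs) \<le> M ^ (2 + 14 + 3)"
    using assms unfolding member_t_def facts_bounded_def
    by (intro snd_any_t_le[OF M] snd_fact_eq_t_le) auto
  then show ?thesis by simp
qed

lemma snd_diff_t_le: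
  assumes "facts_bounded rlen dlen M (set fs)" "facts_bounded rlen dlen M (set gs)"
    and "length fs \<le> M" "length gs \<le> M ^ 2"
  shows "snd (diff_t rlen dlen fs gs) \<le> M ^ 25"
proof -
  have "snd (diff_t rlen dlen fs gs) \<le> M ^ (1 + (19 + 0 + 2) + 3)"
    using assms unfolding diff_t_def
    by (intro snd_filter_t_le[OF M] snd_bindT_le[OF M] snd_member_t_le snd_ret_le[OF M])
      (auto simp: facts_bounded_def)
  then show ?thesis by simp
qed

lemma snd_remove_t_le:
  assumes "fact_len rlen dlen f \<le> M" "facts_bounded rlen dlen M (set gs)" "length gs \<le> M"
  shows "snd (remove_t rlen dlen f gs) \<le> M ^ 18"
proof -
  have "snd (remove_t rlen dlen f gs) \<le> length gs * (M ^ 14 + 3) + 1"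
    using assms(2)
  proof (induction gs)
    case (Cons g gs)
    then have "snd (fact_eq_t rlen dlen f g) \<le> M ^ 14"
      using assms(1) by (intro snd_fact_eq_t_le) (auto simp: facts_bounded_def)
    then show ?case
      using Cons by (auto simp: bindT_def ret_def facts_bounded_def)
  qed (simp add: ret_def)
  also have "\<dots> \<le> M ^ (1 + 14 + 3)"
    using assms(3) by (intro pass_le[OF M]) auto
  finally show ?thesis by simp
qed

lemma snd_prefers_t_le:
  assumes "fact_len rlen dlen x \<le> M" "fact_len rlen dlen y \<le> M"
    and "facts_bounded rlen dlen M (fst ` set P \<union> snd ` set P)" "length P \<le> M"
  shows "snd (prefers_t rlen dlen P y x) \<le> M ^ 34"
proof -
  have "snd (prefers_t rlen dlen P y x) \<le> M ^ (1 + (14 + 14 + 2) + 3)"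
    unfolding prefers_t_def
  proof (intro snd_any_t_le[OF M] snd_bindT_le[OF M])
    fix p assume "p \<in> set P"
    then have p: "fact_len rlen dlen (fst p) \<le> M" "fact_len rlen dlen (snd p) \<le> M"
      using assms(3) by (auto simp: facts_bounded_def)
    then show "snd (fact_eq_t rlen dlen y (fst p)) \<le> M ^ 14"
      using assms by (intro snd_fact_eq_t_le)
    show "snd (if fst (fact_eq_t rlen dlen y (fst p)) then fact_eq_t rlen dlen x (snd p)
        else ret False) \<le> M ^ 14"
      using p assms by (auto intro: snd_fact_eq_t_le snd_ret_le[OF M])
  qed (use assms in auto)
  then show ?thesis
    using le_power_weaken[OF M] by fastforce
qed

lemma snd_append_t_le: "length xs \<le> M ^ i \<Longrightarrow> snd (append_t xs ys) \<le> M ^ (i + 3)"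
  using pass_le[OF M, of "length xs" i 0 0] by (simp add: snd_append_t)

lemma snd_length_t_le: "length xs \<le> M ^ i \<Longrightarrow> snd (length_t xs) \<le> M ^ (i + 3)"
  using pass_le[OF M, of "length xs" i 0 0] by (simp add: snd_length_t)

lemma snd_lookup_t_le: "length env \<le> M ^ i \<Longrightarrow> snd (lookup_t x env) \<le> M ^ (i + 3)"
  using pass_le[OF M, of "length env" i 0 0] snd_lookup_t[of x env] by simp

lemma snd_subs_t_le:
  assumes "2 ^ length xs \<le> M"
  shows "snd (subs_t xs) \<le> M ^ 11"
proof -
  have "10 * 2 ^ length xs \<le> M ^ (10 + 1)"
    using assms by (intro le_power_mult[OF M] le_power_self[OF M]) auto
  then show ?thesis
    using snd_subs_t[of xs] by simp
qed

lemma snd_product_t_le: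
  assumes "length xs \<le> M" "length ys \<le> M"
  shows "snd (product_t xs ys) \<le> M ^ 12"
proof -
  \<comment> \<open>The cost \<open>6 * length ys + 4\<close> for each element is split as
    \<open>T + 3\<close> to fit \<open>pass_le\<close>.\<close>
  have "length xs * ((6 * length ys + 1) + 3) + 1 \<le> M ^ (1 + (6 + 1 + 0 + 1) + 3)"
    using assms M by (intro pass_le[OF M] le_power_add[OF M] le_power_mult[OF M] le_power_self[OF M]) auto
  then show ?thesis
    by (simp add: snd_product_t add.commute)
qed

lemma snd_replace_t_le:
  assumes "facts_bounded rlen dlen M (set I')" "facts_bounded rlen dlen M (set X)"
    and "length I' \<le> M" "length X \<le> M"
  shows "snd (replace_t rlen dlen I' X Y) \<le> M ^ 31"
proof -
  have "length X \<le> M ^ 2"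
    using le_power_weaken[OF M, of "length X" 1 2] assms(4) by simp
  then have "snd (replace_t rlen dlen I' X Y) \<le> M ^ (25 + (1 + 3) + 2)"
    using assms le_trans[OF length_filter_le assms(3)] unfolding replace_t_def
    by (intro snd_bindT_le[OF M] snd_diff_t_le snd_append_t_le) auto
  then show ?thesis by simp
qed

end

section \<open>Costs of checking a fixed set of constraints\<close>

text \<open>
  The exponents now depend on the constraints, and must be chosen before \<^term>\<open>M\<close>, the substitution
  and the facts.
\<close>

lemma snd_match_args_t_le:
  "\<exists>c. \<forall>M vs env. 2 \<le> M \<longrightarrow> env_bounded dlen M e env \<longrightarrow>
     (\<forall>v \<in> set vs. const_len dlen v \<le> M) \<longrightarrow> snd (match_args_t dlen xs vs env) \<le> M ^ c"
proof (induction xs arbitrary: e)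
  case Nil
  then show ?case
    by (intro exI[of _ 0]) (simp add: ret_def)
next
  case (Cons x xs)
  \<comment> \<open>The exponent \<open>e + 1\<close> leaves room for a binding of \<open>x\<close>;
    an environment that is not extended meets this weaker bound too.\<close>
  obtain c where c: "snd (match_args_t dlen xs vs env) \<le> M ^ c"
    if "2 \<le> M" "env_bounded dlen M (e + 1) env" "\<forall>v \<in> set vs. const_len dlen v \<le> M" for M vs env
    using Cons by meson
  show ?case
  proof (intro exI[of _ "(e + 3) + (6 + c + 2) + 2"] allI impI)
    fix M vs env
    assume M: "2 \<le> M" and env: "env_bounded dlen M e env"
      and vs: "\<forall>v \<in> set vs. const_len dlen v \<le> M"
    show "snd (match_args_t dlen (x # xs) vs env) \<le> M ^ ((e + 3) + (6 + c + 2) + 2)"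
    proof (cases vs)
      case Nil
      then show ?thesis
        using snd_ret_le[OF M] by simp
    next
      case (Cons w ws)
      have len: "length env \<le> M ^ e"
        using env by (simp add: env_bounded_def)
      have "length env + 1 \<le> M ^ (e + 1)"
        using le_power_add[OF M len, of 1 0] by simp
      then have "env_bounded dlen M (e + 1) ((x, w) # env)" "env_bounded dlen M (e + 1) env"
        using env vs Cons by (auto simp: env_bounded_def)
      then have c1: "snd (match_args_t dlen xs ws ((x, w) # env)) \<le> M ^ c"
        and c2: "snd (match_args_t dlen xs ws env) \<le> M ^ c"
        using c M vs Cons by auto
      have "snd (case map_of env x of None \<Rightarrow> match_args_t dlen xs ws ((x, w) # env)
          | Some u \<Rightarrow> cmp_t dlen Eq u w \<bind>
              (\<lambda>b. if b then match_args_t dlen xs ws env else ret None)) \<le> M ^ (6 + c + 2)"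
      proof (cases "map_of env x")
        case None
        then show ?thesis
          using le_power_weaken[OF M c1] by simp
      next
        case (Some u)
        then have "const_len dlen u \<le> M"
          using env map_of_SomeD by (force simp: env_bounded_def)
        then have "snd (cmp_t dlen Eq u w) \<le> M ^ 6"
          using snd_cmp_t_le[OF M, of dlen u 1 w 1 Eq] vs Cons by simp
        moreover have "snd (if b then match_args_t dlen xs ws env else ret None) \<le> M ^ c" for b
          using c2 snd_ret_le[OF M] by (cases b) auto
        ultimately have "snd (cmp_t dlen Eq u w \<bind>
            (\<lambda>b. if b then match_args_t dlen xs ws env else ret None)) \<le> M ^ (6 + c + 2)"
          by (rule snd_bindT_le[OF M])
        then show ?thesis
          using Some by simp
      qed
      then show ?thesis
        unfolding Cons match_args_t.simps list.case
        by (intro snd_bindT_le[OF M] snd_lookup_t_le[OF M] len) simp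
    qed
  qed
qed

text \<open>The value of a variable comes from a fact and is at most \<open>M\<close> long. A
  constant of the constraint may be longer than \<open>M\<close>, so its fixed length becomes the
  exponent.\<close>

lemma tm_val_t_le:
  assumes M: "2 \<le> M" and env: "env_bounded dlen M e env"
  shows "snd (tm_val_t env s) \<le> M ^ (e + 3)"
    and "fst (tm_val_t env s) = Some u \<Longrightarrow>
           const_len dlen u \<le> M ^ (case s of Var _ \<Rightarrow> 1 | Const d \<Rightarrow> const_len dlen d)"
proof -
  have len: "length env \<le> M ^ e"
    using env by (simp add: env_bounded_def)
  then show "snd (tm_val_t env s) \<le> M ^ (e + 3)"
    using snd_lookup_t_le[OF M len] snd_ret_le[OF M] by (cases s) simp_all
  show "const_len dlen u \<le> M ^ (case s of Var _ \<Rightarrow> 1 | Const d \<Rightarrow> const_len dlen d)"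
    if "fst (tm_val_t env s) = Some u"
  proof (cases s)
    case (Var x)
    then have "u \<in> snd ` set env"
      using that map_of_SomeD by force
    then have "const_len dlen u \<le> M"
      using env unfolding env_bounded_def by blast
    then show ?thesis
      using Var by simp
  next
    case (Const d)
    then show ?thesis
      using that le_power_self[OF M] by simp
  qed
qed

lemma snd_sat_t_le:
  "\<exists>c. \<forall>M env. 2 \<le> M \<longrightarrow> env_bounded dlen M e env \<longrightarrow> snd (sat_t dlen env \<phi>) \<le> M ^ c"
proof (induction \<phi>)
  case (Cmp r s t)
  define k where "k s = (case s of Var _ \<Rightarrow> 1 | Const d \<Rightarrow> const_len dlen d)" for s :: "'a tm"
  define n where "n = 2 * (k s + k t + 1)"
  show ?case
  proof (intro exI[of _ "(e + 3) + ((e + 3) + n + 2) + 2"] allI impI)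
    fix M env
    assume M: "2 \<le> M" and env: "env_bounded dlen M e env"
    note le = tm_val_t_le[OF M env, folded k_def]
    have "snd (cmp_t dlen r u v) \<le> M ^ n"
      if "fst (tm_val_t env s) = Some u" "fst (tm_val_t env t) = Some v" for u v
      unfolding n_def using that by (intro snd_cmp_t_le[OF M] le(2))
    then have "snd (case (fst (tm_val_t env s), fst (tm_val_t env t)) of
        (Some c, Some d) \<Rightarrow> cmp_t dlen r c d | _ \<Rightarrow> ret False) \<le> M ^ n"
      using snd_ret_le[OF M] by (auto split: option.splits)
    then show "snd (sat_t dlen env (Cmp r s t)) \<le>
        M ^ ((e + 3) + ((e + 3) + n + 2) + 2)"
      unfolding sat_t.simps by (intro snd_bindT_le[OF M] le(1))
  qed
next
  case (Neg \<phi>)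
  then obtain c where c: "snd (sat_t dlen env \<phi>) \<le> M ^ c"
    if "2 \<le> M" "env_bounded dlen M e env" for M env
    by blast
  then have "snd (sat_t dlen env (Neg \<phi>)) \<le> M ^ (c + 0 + 2)"
    if "2 \<le> M" "env_bounded dlen M e env" for M env
    unfolding sat_t.simps using that by (intro snd_bindT_le snd_ret_le)
  then show ?case by blast
next
  case (Conj \<phi> \<psi>)
  then obtain c d where c: "snd (sat_t dlen env \<phi>) \<le> M ^ c" and d: "snd (sat_t dlen env \<psi>) \<le> M ^ d"
    if "2 \<le> M" "env_bounded dlen M e env" for M env
    by metis
  then have "snd (sat_t dlen env (Conj \<phi> \<psi>)) \<le> M ^ (c + (d + 0 + 2) + 2)"
    if "2 \<le> M" "env_bounded dlen M e env" for M env
    unfolding sat_t.simps using that by (intro snd_bindT_le snd_ret_le)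
  then show ?case by blast
next
  case (Disj \<phi> \<psi>)
  then obtain c d where c: "snd (sat_t dlen env \<phi>) \<le> M ^ c" and d: "snd (sat_t dlen env \<psi>) \<le> M ^ d"
    if "2 \<le> M" "env_bounded dlen M e env" for M env
    by metis
  then have "snd (sat_t dlen env (Disj \<phi> \<psi>)) \<le> M ^ (c + (d + 0 + 2) + 2)"
    if "2 \<le> M" "env_bounded dlen M e env" for M env
    unfolding sat_t.simps using that by (intro snd_bindT_le snd_ret_le)
  then show ?case by blast
qed

text \<open>Each atom costs one more pass over \<open>J\<close>, so the exponent grows with the
  number of atoms. This is where fixing the constraints, that is data complexity, is
  essential.\<close>

lemma snd_violates_t_le:
  "\<exists>c. \<forall>M J env. 2 \<le> M \<longrightarrow> env_bounded dlen M e env \<longrightarrow>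
     facts_bounded rlen dlen M (set J) \<longrightarrow> length J \<le> M ^ 2 \<longrightarrow>
     snd (violates_t rlen dlen as \<phi> J env) \<le> M ^ c"
proof (induction as arbitrary: e)
  case Nil
  then show ?case
    using snd_sat_t_le[of dlen e \<phi>] by auto
next
  case (Cons a as)
  \<comment> \<open>Length exponent after matching \<open>a\<close>: its arguments add at most
    \<open>length (snd a)\<close> bindings, and the 1 absorbs the sum.\<close>
  define l where "l = e + length (snd a) + 1"
  obtain c where c: "snd (violates_t rlen dlen as \<phi> J env) \<le> M ^ c"
    if "2 \<le> M" "env_bounded dlen M l env" "facts_bounded rlen dlen M (set J)" "length J \<le> M ^ 2"
    for M J env
    using Cons[of l] by blast
  obtain d where d: "snd (match_args_t dlen (snd a) vs env) \<le> M ^ d"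
    if "2 \<le> M" "env_bounded dlen M e env" "\<forall>v \<in> set vs. const_len dlen v \<le> M" for M vs env
    using snd_match_args_t_le[of dlen e "snd a"] by blast
  define k where "k = (2 + rlen (fst a)) + d + 2"
  show ?case
  proof (intro exI[of _ "2 + (k + c + 2) + 3"] allI impI)
    fix M J env
    assume M: "2 \<le> M" and env: "env_bounded dlen M e env"
      and J: "facts_bounded rlen dlen M (set J)" "length J \<le> M ^ 2"
    have "snd (match_atom_t rlen dlen a f env \<bind> (\<lambda>u. case u of
        None \<Rightarrow> ret False | Some env' \<Rightarrow> violates_t rlen dlen as \<phi> J env')) \<le> M ^ (k + c + 2)"
      if f: "f \<in> set J" for f
    proof (intro snd_bindT_le[OF M])
      have "fact_len rlen dlen f \<le> M"
        using f J(1) by (simp add: facts_bounded_def)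
      note len = fact_len_bounds[OF this]
      have "snd (match_args_t dlen (snd a) (snd f) env) \<le> M ^ d"
        using d M env len(3) by blast
      then show "snd (match_atom_t rlen dlen a f env) \<le> M ^ k"
        unfolding match_atom_t_def k_def
        by (intro snd_bindT_le[OF M] snd_name_eq_t_le[OF M] len(1)) (auto intro: snd_ret_le[OF M])
      show "snd (case fst (match_atom_t rlen dlen a f env) of
          None \<Rightarrow> ret False | Some env' \<Rightarrow> violates_t rlen dlen as \<phi> J env') \<le> M ^ c"
      proof (cases "fst (match_atom_t rlen dlen a f env)")
        case (Some env')
        note m = match_atom_t_Some(3,4)[OF Some]
        have "length env \<le> M ^ e"
          using env by (simp add: env_bounded_def)
        then have "length env + length (snd a) \<le> M ^ l"
          unfolding l_def by (intro le_power_add[OF M] le_power_self[OF M])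
        moreover have "const_len dlen u \<le> M" if "u \<in> snd ` set env'" for u
          using that m(1) env len(3) unfolding env_bounded_def by blast
        ultimately have "env_bounded dlen M l env'"
          using m(2) unfolding env_bounded_def by auto
        then show ?thesis
          using c[OF M _ J] Some by simp
      qed (simp add: snd_ret_le[OF M])
    qed
    then show "snd (violates_t rlen dlen (a # as) \<phi> J env) \<le> M ^ (2 + (k + c + 2) + 3)"
      unfolding violates_t.simps using J(2) by (intro snd_any_t_le[OF M])
  qed
qed

lemma snd_consistent_t_le:
  "\<exists>c. \<forall>M J. 2 \<le> M \<longrightarrow> facts_bounded rlen dlen M (set J) \<longrightarrow> length J \<le> M ^ 2 \<longrightarrow>
     snd (consistent_t rlen dlen F J) \<le> M ^ c"
proof -
  have "\<forall>\<delta>. \<exists>c. \<forall>M J. 2 \<le> M \<longrightarrow> facts_bounded rlen dlen M (set J) \<longrightarrow> length J \<le> M ^ 2 \<longrightarrow>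
     snd (violates_t rlen dlen (atoms \<delta>) (condition \<delta>) J []) \<le> M ^ c"
  proof
    fix \<delta> :: "('a, 'b) dc"
    have "env_bounded dlen M 0 []" for M
      by (simp add: env_bounded_def)
    then show "\<exists>c. \<forall>M J. 2 \<le> M \<longrightarrow> facts_bounded rlen dlen M (set J) \<longrightarrow> length J \<le> M ^ 2 \<longrightarrow>
        snd (violates_t rlen dlen (atoms \<delta>) (condition \<delta>) J []) \<le> M ^ c"
      using snd_violates_t_le[of dlen 0 rlen "atoms \<delta>" "condition \<delta>"] by blast
  qed
  from choice[OF this] obtain c where c:
    "snd (violates_t rlen dlen (atoms \<delta>) (condition \<delta>) J []) \<le> M ^ c \<delta>"
    if "2 \<le> M" "facts_bounded rlen dlen M (set J)" "length J \<le> M ^ 2" for \<delta> M J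
    by blast
  \<comment> \<open>The sum is a convenient common bound for finitely many exponents.\<close>
  define d where "d = (\<Sum>\<delta>\<in>set F. c \<delta>)"
  have d: "c \<delta> \<le> d" if "\<delta> \<in> set F" for \<delta>
    unfolding d_def using that by (intro member_le_sum) auto
  have "snd (consistent_t rlen dlen F J) \<le> M ^ ((length F + d + 3) + 0 + 2)"
    if J: "2 \<le> M" "facts_bounded rlen dlen M (set J)" "length J \<le> M ^ 2" for M J
    unfolding consistent_t_def
    by (intro snd_bindT_le[OF J(1)] snd_any_t_le[OF J(1)] snd_ret_le[OF J(1)] le_power_self[OF J(1)]
        le_power_weaken[OF J(1) c[OF J] d])
  then show ?thesis by blast
qed

section \<open>Costs of single steps and of whole runs\<close>

text \<open>
  The bound \<open>M\<close> covers the sizes of the facts as well as the number of subsets of the instance, so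
  that every step takes time polynomial in \<open>M\<close>.
\<close>

definition input_bounded ::
  "('r \<Rightarrow> nat) \<Rightarrow> ('d \<Rightarrow> nat) \<Rightarrow> nat \<Rightarrow> ('r, 'd) db_fact list \<Rightarrow>
   (('r, 'd) db_fact \<times> ('r, 'd) db_fact) list \<Rightarrow> bool" where
  "input_bounded rlen dlen M I P \<longleftrightarrow>
     2 \<le> M \<and> facts_bounded rlen dlen M (set I) \<and> set P \<subseteq> set I \<times> set I \<and>
     length P \<le> M \<and> 2 ^ length I \<le> M"

lemma snd_improvement_t_le:
  "\<exists>c. \<forall>M I P I' X Y. input_bounded rlen dlen M I P \<longrightarrow>
     set I' \<union> set X \<union> set Y \<subseteq> set I \<longrightarrow> length I' \<le> M \<longrightarrow> length X \<le> M \<longrightarrow> length Y \<le> M \<longrightarrow>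
     snd (improvement_t rlen dlen F P I' X Y) \<le> M ^ c"
proof -
  obtain c where c: "snd (consistent_t rlen dlen F J) \<le> M ^ c"
    if "2 \<le> M" "facts_bounded rlen dlen M (set J)" "length J \<le> M ^ 2" for M J
    using snd_consistent_t_le[of rlen dlen F] by blast
  have "snd (improvement_t rlen dlen F P I' X Y) \<le> M ^ ((1 + (1 + 34 + 3) + 3) + (31 + c + 2) + 2)"
    if bnd: "input_bounded rlen dlen M I P" and sub: "set I' \<union> set X \<union> set Y \<subseteq> set I"
      and len: "length I' \<le> M" "length X \<le> M" "length Y \<le> M" for M I P I' X Y
  proof -
    have M: "2 \<le> M" and P: "length P \<le> M"
      using bnd by (auto simp: input_bounded_def)
    have facts: "fact_len rlen dlen f \<le> M" if "f \<in> set I" for f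
      using bnd that by (auto simp: input_bounded_def facts_bounded_def)
    have a: "snd (all_t (\<lambda>x. any_t (\<lambda>y. prefers_t rlen dlen P y x) Y) X) \<le> M ^ (1 + (1 + 34 + 3) + 3)"
      using len sub P facts bnd
      by (intro snd_all_t_le[OF M] snd_any_t_le[OF M] snd_prefers_t_le[OF M])
        (auto simp: input_bounded_def facts_bounded_def)
    have "snd (replace_t rlen dlen I' X Y \<bind> (\<lambda>J. consistent_t rlen dlen F J)) \<le>
        M ^ (31 + c + 2)"
    proof (intro snd_bindT_le[OF M])
      show "snd (replace_t rlen dlen I' X Y) \<le> M ^ 31"
        using sub facts len by (intro snd_replace_t_le[OF M]) (auto simp: facts_bounded_def)
      have "length (filter (\<lambda>f. f \<notin> set X) I' @ Y) \<le> 2 * M"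
        using len le_trans[OF length_filter_le len(1), of "\<lambda>f. f \<notin> set X"] by simp
      also have "\<dots> \<le> M ^ 2"
        using M by (simp add: power2_eq_square)
      finally show "snd (consistent_t rlen dlen F (fst (replace_t rlen dlen I' X Y))) \<le> M ^ c"
        using sub facts by (intro c[OF M]) (auto simp: facts_bounded_def)
    qed
    then have "snd (if b then replace_t rlen dlen I' X Y \<bind> (\<lambda>J. consistent_t rlen dlen F J)
        else ret False) \<le> M ^ (31 + c + 2)" for b
      using snd_ret_le[OF M] by (cases b) auto
    from snd_bindT_le[OF M a this] show ?thesis
      unfolding improvement_t_def using snd_ret_le[OF M] by (cases "X = []") simp_all
  qed
  then show ?thesis by blast
qed

lemma two_power_bounds:
  assumes "2 ^ n \<le> (M::nat)" "m \<le> n"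
  shows "m \<le> M" "2 ^ m \<le> M"
proof -
  have "(2::nat) ^ m \<le> 2 ^ n"
    using assms(2) by (simp add: power_increasing)
  then show "2 ^ m \<le> M"
    using assms(1) by (rule le_trans)
  then show "m \<le> M"
    using less_exp[of m] by linarith
qed

text \<open>\<open>I'\<close> and its complement have at most \<open>M\<close> subsequences each,
  hence at most \<open>M ^ 2\<close> pairs. The bound on the result is needed for the traversal
  charged when a pair is chosen.\<close>

lemma snd_improvements_t_le:
  "\<exists>c. \<forall>M I P I'. input_bounded rlen dlen M I P \<longrightarrow> set I' \<subseteq> set I \<longrightarrow> length I' \<le> length I \<longrightarrow>
     snd (improvements_t rlen dlen F I P I') \<le> M ^ c \<and>
     length (fst (improvements_t rlen dlen F I P I')) \<le> M ^ 2"
proof -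
  obtain c where c: "snd (improvement_t rlen dlen F P I' X Y) \<le> M ^ c"
    if "input_bounded rlen dlen M I P" "set I' \<union> set X \<union> set Y \<subseteq> set I"
      "length I' \<le> M" "length X \<le> M" "length Y \<le> M" for M I P I' X Y
    using snd_improvement_t_le[of rlen dlen F] by blast
  have "snd (improvements_t rlen dlen F I P I') \<le>
      M ^ (11 + (25 + (11 + (12 + (2 + c + 3) + 2) + 2) + 2) + 2) \<and>
     length (fst (improvements_t rlen dlen F I P I')) \<le> M ^ 2"
    if bnd: "input_bounded rlen dlen M I P" and I': "set I' \<subseteq> set I" "length I' \<le> length I"
    for M I P I'
  proof -
    have M: "2 \<le> M" "2 ^ length I \<le> M" "facts_bounded rlen dlen M (set I)"
      using bnd by (auto simp: input_bounded_def)
    define K where "K = filter (\<lambda>f. f \<notin> set I') I"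
    have K: "length K \<le> length I"
      by (simp add: K_def)
    note le = two_power_bounds[OF M(2) I'(2)] two_power_bounds[OF M(2) K]
      two_power_bounds[OF M(2) order_refl]
    define ps where "ps = List.product (subseqs I') (subseqs K)"
    have ps: "length ps \<le> M ^ 2"
      using le by (simp add: ps_def length_subseqs power2_eq_square mult_le_mono)
    have "snd (improvement_t rlen dlen F P I' (fst p) (snd p)) \<le> M ^ c" if "p \<in> set ps" for p
    proof -
      have p: "fst p \<in> set (subseqs I')" "snd p \<in> set (subseqs K)"
        using that by (auto simp: ps_def)
      have "set (fst p) \<subseteq> set I" "set (snd p) \<subseteq> set I"
        using subseqs_subset[OF p(1)] subseqs_subset[OF p(2)] I' by (auto simp: K_def)
      moreover have "length (fst p) \<le> M" "length (snd p) \<le> M"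
        using subseqs_length[OF p(1)] subseqs_length[OF p(2)] le by linarith+
      ultimately show ?thesis
        using I' le by (intro c[OF bnd]) auto
    qed
    then have "snd (filter_t (\<lambda>p. improvement_t rlen dlen F P I' (fst p) (snd p)) ps) \<le> M ^ (2 + c + 3)"
      using ps by (intro snd_filter_t_le[OF M(1)])
    moreover have "snd (subs_t I') \<le> M ^ 11" "snd (subs_t K) \<le> M ^ 11"
      using le by (auto intro!: snd_subs_t_le[OF M(1)])
    moreover have "snd (diff_t rlen dlen I I') \<le> M ^ 25"
      using le facts_bounded_subset[OF M(3) I'(1)] M le_power_weaken[OF M(1), of "length I'" 1 2]
      by (intro snd_diff_t_le[OF M(1)]) auto
    moreover have "snd (product_t (subseqs I') (subseqs K)) \<le> M ^ 12"
      using le by (intro snd_product_t_le[OF M(1)]) (auto simp: length_subseqs)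
    ultimately have "snd (improvements_t rlen dlen F I P I') \<le>
        M ^ (11 + (25 + (11 + (12 + (2 + c + 3) + 2) + 2) + 2) + 2)"
      unfolding improvements_t_def
      by (intro snd_bindT_le[OF M(1)]) (simp_all add: K_def ps_def)
    moreover have "length (fst (improvements_t rlen dlen F I P I')) \<le> length ps"
      by (simp add: improvements_t_def ps_def K_def length_filter_le del: length_product)
    ultimately show ?thesis
      using ps by simp
  qed
  then show ?thesis by blast
qed

text \<open>The two invariants keep the lists in a state duplicate-free and within \<open>I\<close>,
  hence no longer than \<open>I\<close>, which is what lets \<open>input_bounded\<close> control
  every step.\<close>

lemma exec_step_time:
  "\<exists>c. \<forall>M I P s t s'. input_bounded rlen dlen M I P \<longrightarrow> distinct I \<longrightarrow> list_invariant s \<longrightarrow>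
     gr_invariant (set F) (set I) (set P) (map_state set s) \<longrightarrow>
     exec_step rlen dlen F I P s t s' \<longrightarrow> t \<le> M ^ c"
proof -
  obtain c where c: "snd (consistent_t rlen dlen F J) \<le> M ^ c"
    if "2 \<le> M" "facts_bounded rlen dlen M (set J)" "length J \<le> M ^ 2" for M J
    using snd_consistent_t_le[of rlen dlen F] by blast
  obtain d where d: "snd (improvements_t rlen dlen F I P I') \<le> M ^ d"
    "length (fst (improvements_t rlen dlen F I P I')) \<le> M ^ 2"
    if "input_bounded rlen dlen M I P" "set I' \<subseteq> set I" "length I' \<le> length I" for M I P I'
    using snd_improvements_t_le[of rlen dlen F] by blast
  \<comment> \<open>100 is a round number above the constants of all four kinds of steps, compared
    in \<open>w\<close>.\<close>
  have "t \<le> M ^ (c + d + 100)"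
    if bnd: "input_bounded rlen dlen M I P" and "distinct I" and linv: "list_invariant s"
      and inv: "gr_invariant (set F) (set I) (set P) (map_state set s)"
      and step: "exec_step rlen dlen F I P s t s'" for M I P s t s'
  proof -
    have M: "2 \<le> M" "2 ^ length I \<le> M" and facts: "facts_bounded rlen dlen M (set I)"
      using bnd by (auto simp: input_bounded_def)
    have sq: "2 * M \<le> M ^ 2"
      using M(1) by (simp add: power2_eq_square)
    have len: "length J \<le> length I" "length J \<le> M" if "distinct J" "set J \<subseteq> set I" for J
    proof -
      have "card (set J) \<le> card (set I)"
        using that by (intro card_mono) auto
      then show "length J \<le> length I"
        using that \<open>distinct I\<close> by (simp add: distinct_card)
      then show "length J \<le> M"
        by (rule two_power_bounds[OF M(2)])
    qed
    have w: "c + (18 + 0 + 2) + 2 \<le> c + d + 100"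
      "(d + (2 + 3) + 1) + (31 + (25 + 0 + 2) + 2) + 1 \<le> c + d + 100" "d + 0 + 1 \<le> c + d + 100"
      by simp_all
    from step show ?thesis
    proof cases
      case (1 f R J)
      have J: "distinct J" "set J \<subseteq> set I" and R: "distinct R" "set R \<subseteq> set I"
        using linv inv 1 by auto
      have f: "f \<in> set I"
        using 1 R by blast
      have "length (f # J) \<le> M ^ 2"
        using len(2)[OF J] sq M(1) by simp
      then have "snd (consistent_t rlen dlen F (f # J)) \<le> M ^ c"
        using J f by (intro c[OF M(1)] facts_bounded_subset[OF facts]) auto
      moreover have "snd (remove_t rlen dlen f R) \<le> M ^ 18"
        using facts f len(2)[OF R] facts_bounded_subset[OF facts R(2)]
        by (intro snd_remove_t_le[OF M(1)]) (auto simp: facts_bounded_def)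
      ultimately have "snd (consider_t rlen dlen F J R f) \<le> M ^ (c + (18 + 0 + 2) + 2)"
        unfolding consider_t_def by (intro snd_bindT_le[OF M(1)] snd_ret_le[OF M(1)])
      moreover have "t = snd (consider_t rlen dlen F J R f)"
        using 1 by simp
      ultimately show ?thesis
        by (metis le_power_weaken[OF M(1)] w(1))
    next
      case (2 J)
      then show ?thesis
        using M(1) by simp
    next
      case (3 I' ps t1 X Y t2)
      have I': "distinct I'" "set I' \<subseteq> set I"
        using linv inv 3 by (auto simp: repair_def)
      note d = d[OF bnd I'(2) len(1)[OF I']]
      have "(X, Y) \<in> set (fst (improvements_t rlen dlen F I P I'))"
        using 3 by simp
      then have XY: "X \<in> set (subseqs I')" "Y \<in> set (subseqs (filter (\<lambda>f. f \<notin> set I') I))"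
        by (auto simp: improvements_t_def)
      have X: "set X \<subseteq> set I" "length X \<le> M"
        using subseqs_subset[OF XY(1)] subseqs_length[OF XY(1)] I' len(2)[OF I'] by auto
      have Y: "set Y \<subseteq> set I" "length Y \<le> M"
        using subseqs_subset[OF XY(2)] le_trans[OF subseqs_length[OF XY(2)] length_filter_le]
          two_power_bounds(1)[OF M(2), of "length Y"] by auto
      define J where "J = filter (\<lambda>f. f \<notin> set X) I' @ Y"
      have "length J \<le> 2 * M"
        using Y(2) le_trans[OF length_filter_le len(2)[OF I'], of "\<lambda>f. f \<notin> set X"]
        by (simp add: J_def)
      then have J: "length J \<le> M ^ 2" "set J \<subseteq> set I"
        using sq I' Y(1) by (auto simp: J_def)
      have "snd (replace_t rlen dlen I' X Y) \<le> M ^ 31"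
        using X len(2)[OF I'] I' by (intro snd_replace_t_le[OF M(1)] facts_bounded_subset[OF facts])
      moreover have "snd (diff_t rlen dlen I J) \<le> M ^ 25"
        using J len(2)[OF \<open>distinct I\<close>]
        by (intro snd_diff_t_le[OF M(1)] facts_bounded_subset[OF facts]) auto
      ultimately have "snd (improve_t rlen dlen I I' X Y) \<le> M ^ (31 + (25 + 0 + 2) + 2)"
        unfolding improve_t_def
        by (intro snd_bindT_le[OF M(1)] snd_ret_le[OF M(1)]) (simp_all add: J_def)
      moreover have "snd (length_t ps) \<le> M ^ (2 + 3)"
        using d(2) 3 by (intro snd_length_t_le[OF M(1)]) simp
      ultimately have "t1 + snd (length_t ps) + t2 \<le>
          M ^ ((d + (2 + 3) + 1) + (31 + (25 + 0 + 2) + 2) + 1)"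
        using d(1) 3 by (intro le_power_add[OF M(1)]) simp_all
      then show ?thesis
        unfolding 3(2) by (rule le_power_weaken[OF M(1)]) (rule w(2))
    next
      case (4 I' t1)
      have I': "distinct I'" "set I' \<subseteq> set I"
        using linv inv 4 by (auto simp: repair_def)
      have "t1 + 1 \<le> M ^ (d + 0 + 1)"
        using d(1)[OF bnd I'(2) len(1)[OF I']] 4 by (intro le_power_add[OF M(1)]) auto
      then show ?thesis
        unfolding 4(2) by (rule le_power_weaken[OF M(1)]) (rule w(3))
    qed
  qed
  then show ?thesis by blast
qed

text \<open>Each list step projects to a set step, which lowers the measure by at least 1 and is
  charged at most \<open>T\<close>. The measure of the first state thus bounds the number of steps
  of any run, finished or not.\<close>

lemma exec_time:
  assumes dc: "\<forall>\<delta> \<in> set F. denial_constraint S \<delta>" and "distinct I"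
    and r: "inj_on r (set I)" "r ` set I \<subseteq> {..<card (set I)}"
      "\<forall>(y, x) \<in> set P. y \<in> set I \<longrightarrow> x \<in> set I \<longrightarrow> r x < r y"
    and T: "\<And>s t s'. list_invariant s \<Longrightarrow> gr_invariant (set F) (set I) (set P) (map_state set s) \<Longrightarrow>
      exec_step rlen dlen F I P s t s' \<Longrightarrow> t \<le> T"
    and "exec rlen dlen F I P s t s'" "list_invariant s"
      "gr_invariant (set F) (set I) (set P) (map_state set s)"
  shows "list_invariant s' \<and> t \<le> gr_measure (card (set I)) r (map_state set s) * T"
  using assms(7-9)
proof (induction rule: exec.induct)
  case (2 s t s' u s'')
  let ?m = "\<lambda>s. gr_measure (card (set I)) r (map_state set s)"
  have step: "gr_step (set F) (set I) (set P) (map_state set s) (map_state set s')"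
    using implements_at[OF dc 2(4), of rlen dlen I P] 2(1) unfolding implements_at_def by blast
  have "list_invariant s'" "gr_invariant (set F) (set I) (set P) (map_state set s')"
    using exec_step_list_invariant[OF dc \<open>distinct I\<close> 2(1) 2(4)] gr_step_invariant[OF step 2(5)]
    by auto
  then have IH: "list_invariant s''" "u \<le> ?m s' * T"
    using 2(3) by auto
  have "Suc (?m s') \<le> ?m s"
    using gr_step_measure[OF _ r 2(5) step] by simp
  have "t + u \<le> Suc (?m s') * T"
    using T[OF 2(4,5,1)] IH(2) by simp
  also have "\<dots> \<le> ?m s * T"
    using \<open>Suc (?m s') \<le> ?m s\<close> by (rule mult_le_mono1)
  finally show ?case
    using IH(1) by simp
qed simp

text \<open>Each fact has length at least 1, so the size bounds the number of facts and of priority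
  pairs. The \<open>+ 1\<close> in the exponent gives \<open>2 \<le> M\<close> even for an empty
  input.\<close>

lemma input_bounded_size:
  assumes "distinct I" "distinct P" "set P \<subseteq> set I \<times> set I"
  shows "input_bounded rlen dlen (2 ^ (input_size rlen dlen (set I) (set P) + 1)) I P"
proof -
  define N where "N = input_size rlen dlen (set I) (set P)"
  have N: "(\<Sum>f\<in>set I. fact_len rlen dlen f) \<le> N"
    "(\<Sum>(f, g)\<in>set P. fact_len rlen dlen f + fact_len rlen dlen g) \<le> N"
    by (auto simp: N_def input_size_def)
  have pos: "1 \<le> fact_len rlen dlen f" for f :: "('a, 'b) db_fact"
    by (simp add: fact_len_def)
  have "card (set I) \<le> (\<Sum>f\<in>set I. fact_len rlen dlen f)"
    using sum_mono[of "set I" "\<lambda>_. 1" "fact_len rlen dlen"] pos by simp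
  then have I: "length I \<le> N"
    using N(1) assms(1) by (simp add: distinct_card)
  have "card (set P) \<le> (\<Sum>(f, g)\<in>set P. fact_len rlen dlen f + fact_len rlen dlen g)"
    using sum_mono[of "set P" "\<lambda>_. 1" "\<lambda>(f, g). fact_len rlen dlen f + fact_len rlen dlen g"] pos
    by (auto simp: trans_le_add1)
  then have P: "length P \<le> N"
    using N(2) assms(2) by (simp add: distinct_card)
  have facts: "fact_len rlen dlen f \<le> N" if "f \<in> set I" for f
    using member_le_sum[OF that, of "fact_len rlen dlen"] N(1) by simp
  have "N \<le> 2 ^ (N + 1)"
    using less_exp[of "N + 1"] by linarith
  moreover have "(2::nat) ^ length I \<le> 2 ^ (N + 1)"
    using I by (intro power_increasing) auto
  moreover have "(2::nat) \<le> 2 ^ (N + 1)"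
    by simp
  ultimately show ?thesis
    unfolding input_bounded_def facts_bounded_def N_def[symmetric]
    using assms(3) P facts by (meson le_trans)
qed

lemma exec_time_exponential:
  assumes dc: "\<forall>\<delta> \<in> set F. denial_constraint S \<delta>"
  shows "\<exists>c. \<forall>I P t s. distinct I \<longrightarrow> distinct P \<longrightarrow> priority (set F) (set I) (set P) \<longrightarrow>
    exec rlen dlen F I P (exec_init I) t s \<longrightarrow>
    implements_at rlen dlen F I P s \<and> t \<le> 2 ^ (c * (input_size rlen dlen (set I) (set P) + 1))"
proof -
  obtain e where e: "t \<le> M ^ e"
    if "input_bounded rlen dlen M I P" "distinct I" "list_invariant s"
      "gr_invariant (set F) (set I) (set P) (map_state set s)" "exec_step rlen dlen F I P s t s'"
    for M I P s t s'
    using exec_step_time[of rlen dlen F] by blast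
  have "implements_at rlen dlen F I P s \<and>
      t \<le> 2 ^ ((11 + e) * (input_size rlen dlen (set I) (set P) + 1))"
    if "distinct I" "distinct P" and prio: "priority (set F) (set I) (set P)"
      and ex: "exec rlen dlen F I P (exec_init I) t s" for I P t s
  proof -
    define M where "M = (2::nat) ^ (input_size rlen dlen (set I) (set P) + 1)"
    have P: "set P \<subseteq> set I \<times> set I" "acyclic (set P)"
      using prio by (auto simp: priority_def)
    have bnd: "input_bounded rlen dlen M I P"
      unfolding M_def by (rule input_bounded_size[OF that(1,2) P(1)])
    obtain r :: "_ \<Rightarrow> nat" where r: "inj_on r (set I)" "r ` set I \<subseteq> {..<card (set I)}"
      "\<forall>(y, x) \<in> set P. y \<in> set I \<longrightarrow> x \<in> set I \<longrightarrow> r x < r y"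
      using finite_acyclic_ranking[OF finite_set P(2)] by meson
    have init: "list_invariant (exec_init I)" "map_state set (exec_init I) = gr_init (set I)"
      using that(1) by (auto simp: exec_init_def gr_init_def)
    then have "gr_invariant (set F) (set I) (set P) (map_state set (exec_init I))"
      using gr_invariant_init[OF dc] by simp
    from exec_time[OF dc that(1) r e[OF bnd that(1)] ex init(1) this]
    have s: "list_invariant s" and t: "t \<le> gr_measure (card (set I)) r (gr_init (set I)) * M ^ e"
      unfolding init(2) by auto
    have M: "2 \<le> M" "2 ^ length I \<le> M"
      using bnd by (auto simp: input_bounded_def)
    have "length I \<le> M"
      using two_power_bounds(1)[OF M(2)] by blast
    \<comment> \<open>The left-hand side is the initial measure, with weight 0 and all facts queued;
      the exponents add up to 11.\<close>
    then have "2 ^ length I * (length I + 3) + (length I + 2) \<le> M ^ ((1 + (1 + 3 + 1)) + (1 + 2 + 1) + 1)"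
      using M(2)
      by (intro le_power_add[OF M(1)] le_power_mult[OF M(1)] le_power_self[OF M(1)]) auto
    then have "gr_measure (card (set I)) r (gr_init (set I)) \<le> M ^ 11"
      using that(1) by (simp add: gr_init_def weight_def distinct_card)
    then have "gr_measure (card (set I)) r (gr_init (set I)) * M ^ e \<le> M ^ (11 + e)"
      by (intro le_power_mult[OF M(1)]) auto
    also have "M ^ (11 + e) = 2 ^ ((11 + e) * (input_size rlen dlen (set I) (set P) + 1))"
      unfolding M_def by (simp only: power_mult[symmetric] mult.commute)
    finally show ?thesis
      using t implements_at[OF dc s] by (meson le_trans)
  qed
  then show ?thesis by blast
qed

theorem theorem1:
  fixes S :: "'r schema" and F :: "('r, 'd) dc set"
    and rlen :: "'r \<Rightarrow> nat" and dlen :: "'d \<Rightarrow> nat"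
  assumes "infinite (UNIV :: 'd set)"
    and "db_schema S"
    and "finite F"
    and "\<forall>\<delta> \<in> F. denial_constraint S \<delta>"
  shows
    "(\<forall>I P. db_instance S I \<and> priority F I P \<longrightarrow>
        gr_terminates F I P \<and>
        (\<forall>I'. gr_reaches F I P (Returned I') \<longleftrightarrow> repair F I I' \<and> globally_optimal F I P I')) \<and>
     (\<forall>Fs. set Fs = F \<longrightarrow>
        (\<exists>c::nat. \<forall>I P Is Ps.
           db_instance S I \<and> priority F I P \<and>
           distinct Is \<and> set Is = I \<and> distinct Ps \<and> set Ps = P \<longrightarrow>
           (\<forall>t s. exec rlen dlen Fs Is Ps (exec_init Is) t s \<longrightarrow>
              implements_at rlen dlen Fs Is Ps s \<and>
              t \<le> 2 ^ (c * (input_size rlen dlen I P + 1)))))"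
proof (intro conjI allI impI)
  fix I P
  assume I: "db_instance S I \<and> priority F I P"
  then have "finite I"
    by (simp add: db_instance_def)
  then show "gr_terminates F I P"
    using I by (intro gr_terminates[OF _ _ assms(4)]) auto
  show "gr_reaches F I P (Returned I') \<longleftrightarrow> repair F I I' \<and> globally_optimal F I P I'" for I'
    by (rule gr_reaches_Returned_iff[OF \<open>finite I\<close> assms(4)])
next
  fix Fs
  assume "set Fs = F"
  then show "\<exists>c::nat. \<forall>I P Is Ps.
           db_instance S I \<and> priority F I P \<and>
           distinct Is \<and> set Is = I \<and> distinct Ps \<and> set Ps = P \<longrightarrow>
           (\<forall>t s. exec rlen dlen Fs Is Ps (exec_init Is) t s \<longrightarrow>
              implements_at rlen dlen Fs Is Ps s \<and>
              t \<le> 2 ^ (c * (input_size rlen dlen I P + 1)))"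
    using exec_time_exponential[of Fs S rlen dlen] assms(4) by blast
qed

end
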